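(* Let $(N_t)_{t\ge0}$ be a Brownian motion in $\mathbb R^n$ with $N_0=0$ a.s., let $U:\mathbb R^n\to\mathbb R$ be a $C^2$ function such that $\nabla U$ is Lipschitz, and for $x\in\mathbb R^n$ let $(X_t^x)_{t\ge0}$ be the unique solution of $$dX_t^x=-\nabla U(X_t^x)\,dt+dN_t,\qquad X_0^x=x.$$ Let $P_tf(x)=\mathbb E(f(X_t^x))$. Assume that the normalized invariant measure $d\mu=\frac1Z e^{-U(x)}\,dx$ is a probability measure with a finite second moment and that $\nabla^2U\ge0$ (i.e. $U$ is convex). Then for every $x\in\mathbb R^n$ and $t>0$, $$\mathsf{He}_2(\delta_xP_t,\mu)^2\le\frac1{4t}\,W_2(\delta_x,\mu)^2.$$ In particular, $X_t^x$ converges in total variation to $\mu$ when $t\to+\infty$.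
   Context: $P_t$ is viewed as the Markov kernel $P_t(x,A)=\mathbb P(X_t^x\in A)$, so $\delta_xP_t$ is the law of $X_t^x$, where $\delta_x$ is the Dirac measure at $x$. $\nabla^2U$ is the Hessian of $U$, and $Z$ is the normalization constant. $W_2(\mu_0,\mu_1)^2=\inf_\pi\int|x_0-x_1|^2\,\pi(dx_0,dx_1)$, the infimum being over couplings $\pi$ of the probability measures $\mu_0,\mu_1$ on $\mathbb R^n$. $\mathsf{He}_2(\mu_0,\mu_1)^2=\int\left(\sqrt{d\mu_1/dm}-\sqrt{d\mu_0/dm}\right)^2dm$ for any measure $m$ with respect to which $\mu_0,\mu_1$ are both absolutely continuous (the value does not depend on $m$).
   Formalization: The Brownian motion N is normalized to have covariance 2tI (generator Δ−∇U·∇); for standard Brownian motion e^{-U}/Z is not invariant and the total variation claim fails, e.g. for U=|x|²/2. *)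

theory Defs
  imports "HOL-Probability.Probability"
begin

section \<open>Differential calculus on \<open>\<real>\<^sup>n\<close>\<close>

definition gradient :: "(real ^ 'n \<Rightarrow> real) \<Rightarrow> real ^ 'n \<Rightarrow> real ^ 'n" where
  "gradient U x = (THE D. GDERIV U x :> D)"

definition hessian :: "(real ^ 'n \<Rightarrow> real) \<Rightarrow> real ^ 'n \<Rightarrow> real ^ 'n ^ 'n" where
  "hessian U x = matrix (frechet_derivative (gradient U) (at x))"

definition C2 :: "(real ^ 'n \<Rightarrow> real) \<Rightarrow> bool" where
  "C2 U \<longleftrightarrow> (\<forall>x. U differentiable (at x)) \<and> (\<forall>x. gradient U differentiable (at x))
     \<and> continuous_on UNIV (hessian U)"


section \<open>Brownian motion and the diffusion\<close>

text \<open>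
  \<open>v\<close> is the variance per unit of time: the increment over \<open>[s, t]\<close> has law \<open>N(0, v (t - s) I)\<close>.
  Standard Brownian motion is the case \<open>v = 1\<close>. The equation \<open>dX = - \<nabla>U(X) dt + dN\<close> has generator
  \<open>f \<mapsto> (v / 2) \<Delta>f - \<nabla>U \<bullet> \<nabla>f\<close>, whose invariant measure is proportional to \<open>exp (- 2 U / v)\<close>;
  hence \<open>exp (- U)\<close> is the invariant density exactly under the normalization \<open>v = 2\<close>.
  Time is \<open>[0, \<infinity>)\<close>; the values at negative times are irrelevant.
\<close>

definition brownian_motion :: "'a measure \<Rightarrow> real \<Rightarrow> (real \<Rightarrow> 'a \<Rightarrow> real ^ 'n) \<Rightarrow> bool" where
  "brownian_motion M v N \<longleftrightarrow>
     prob_space M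
   \<and> (\<forall>t\<ge>0. N t \<in> borel_measurable M)
   \<and> (AE \<omega> in M. N 0 \<omega> = 0)
   \<and> (AE \<omega> in M. continuous_on {0..} (\<lambda>t. N t \<omega>))
   \<and> (\<forall>s\<ge>0. \<forall>t>s. distributed M lborel (\<lambda>\<omega>. N t \<omega> - N s \<omega>)
         (\<lambda>y. ennreal (\<Prod>i\<in>UNIV. normal_density 0 (sqrt (v * (t - s))) (y $ i))))
   \<and> (\<forall>(\<tau>::nat \<Rightarrow> real) k. 0 \<le> \<tau> 0 \<longrightarrow> (\<forall>i<k. \<tau> i \<le> \<tau> (Suc i)) \<longrightarrow>
         prob_space.indep_vars M (\<lambda>_. borel) (\<lambda>i \<omega>. N (\<tau> (Suc i)) \<omega> - N (\<tau> i) \<omega>) {..<k})"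

text \<open>
  The noise is additive, so \<open>dX = - \<nabla>U(X) dt + dN\<close>, \<open>X\<^sub>0 = x\<close> is read pathwise as an integral
  equation. When \<open>\<nabla>U\<close> is Lipschitz, any two solutions are indistinguishable.
\<close>

definition langevin_solution ::
  "'a measure \<Rightarrow> (real \<Rightarrow> 'a \<Rightarrow> real ^ 'n) \<Rightarrow> (real ^ 'n \<Rightarrow> real) \<Rightarrow> real ^ 'n
     \<Rightarrow> (real \<Rightarrow> 'a \<Rightarrow> real ^ 'n) \<Rightarrow> bool" where
  "langevin_solution M N U x X \<longleftrightarrow>
     (\<forall>t\<ge>0. X t \<in> borel_measurable M)
   \<and> (AE \<omega> in M. X 0 \<omega> = x \<and> continuous_on {0..} (\<lambda>t. X t \<omega>)
        \<and> (\<forall>t\<ge>0. X t \<omega> = x - integral {0..t} (\<lambda>s. gradient U (X s \<omega>)) + N t \<omega>))"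

text \<open>The measure \<open>\<delta>\<^sub>x P\<^sub>t = P\<^sub>t(x, \<cdot>)\<close>, that is the law of \<open>X\<^sub>t\<^sup>x\<close>.\<close>

definition dirac_semigroup ::
  "'a measure \<Rightarrow> (real ^ 'n \<Rightarrow> real \<Rightarrow> 'a \<Rightarrow> real ^ 'n) \<Rightarrow> real ^ 'n \<Rightarrow> real \<Rightarrow> (real ^ 'n) measure" where
  "dirac_semigroup M X x t = distr M borel (X x t)"

text \<open>
  If \<open>exp (- U)\<close> is not integrable, the Bochner integral is \<open>0\<close> and this is the null measure; so
  \<open>prob_space (gibbs_measure U)\<close> holds exactly when the normalization constant is finite.
\<close>

definition gibbs_measure :: "(real ^ 'n \<Rightarrow> real) \<Rightarrow> (real ^ 'n) measure" where
  "gibbs_measure U =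
     density lborel (\<lambda>x. ennreal (exp (- U x) / (\<integral>y. exp (- U y) \<partial>lborel)))"


section \<open>Distances between probability measures\<close>

definition couplings ::
  "'b::topological_space measure \<Rightarrow> 'b measure \<Rightarrow> ('b \<times> 'b) measure set" where
  "couplings \<mu>0 \<mu>1 = {\<pi>. sets \<pi> = sets (borel \<Otimes>\<^sub>M borel)
     \<and> distr \<pi> borel fst = \<mu>0 \<and> distr \<pi> borel snd = \<mu>1}"

definition wasserstein2_sq ::
  "'b::real_normed_vector measure \<Rightarrow> 'b measure \<Rightarrow> ennreal" where
  "wasserstein2_sq \<mu>0 \<mu>1 =
     (INF \<pi>\<in>couplings \<mu>0 \<mu>1. \<integral>\<^sup>+ z. ennreal ((norm (fst z - snd z))\<^sup>2) \<partial>\<pi>)"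

definition hellinger2_sq_wrt :: "'b measure \<Rightarrow> 'b measure \<Rightarrow> 'b measure \<Rightarrow> ennreal" where
  "hellinger2_sq_wrt m \<mu>0 \<mu>1 =
     (\<integral>\<^sup>+ x. ennreal ((sqrt (enn2real (RN_deriv m \<mu>1 x)) - sqrt (enn2real (RN_deriv m \<mu>0 x)))\<^sup>2) \<partial>m)"

definition measure_add :: "'b measure \<Rightarrow> 'b measure \<Rightarrow> 'b measure" where
  "measure_add \<mu>0 \<mu>1 =
     measure_of (space \<mu>0) (sets \<mu>0) (\<lambda>A. emeasure \<mu>0 A + emeasure \<mu>1 A)"

text \<open>
  The choice of the dominating measure \<open>\<mu>0 + \<mu>1\<close> is immaterial, see \<open>hellinger2_sq_eq_wrt\<close> below.
\<close>

definition hellinger2_sq :: "'b measure \<Rightarrow> 'b measure \<Rightarrow> ennreal" where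
  "hellinger2_sq \<mu>0 \<mu>1 = hellinger2_sq_wrt (measure_add \<mu>0 \<mu>1) \<mu>0 \<mu>1"

definition total_variation :: "'b measure \<Rightarrow> 'b measure \<Rightarrow> real" where
  "total_variation \<mu>0 \<mu>1 = (SUP A\<in>sets \<mu>0. \<bar>measure \<mu>0 A - measure \<mu>1 A\<bar>)"

lemma sets_measure_add [simp]: "sets (measure_add \<mu>0 \<mu>1) = sets \<mu>0"
  unfolding measure_add_def by (simp add: sets.space_closed sets.sigma_sets_eq)

lemma space_measure_add [simp]: "space (measure_add \<mu>0 \<mu>1) = space \<mu>0"
  unfolding measure_add_def by (simp add: space_measure_of_conv)

lemma emeasure_measure_add:
  assumes "sets \<mu>0 = sets \<mu>1" "A \<in> sets \<mu>0"
  shows "emeasure (measure_add \<mu>0 \<mu>1) A = emeasure \<mu>0 A + emeasure \<mu>1 A"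
proof (rule emeasure_measure_of[OF measure_add_def])
  show "countably_additive (sets (measure_add \<mu>0 \<mu>1)) (\<lambda>A. emeasure \<mu>0 A + emeasure \<mu>1 A)"
  proof (rule countably_additiveI)
    fix B :: "nat \<Rightarrow> _"
    assume "range B \<subseteq> sets (measure_add \<mu>0 \<mu>1)" "disjoint_family B"
    then show "(\<Sum>i. emeasure \<mu>0 (B i) + emeasure \<mu>1 (B i)) =
        emeasure \<mu>0 (\<Union>i. B i) + emeasure \<mu>1 (\<Union>i. B i)"
      using assms(1) by (subst suminf_add[symmetric]) (auto simp: suminf_emeasure)
  qed
qed (use assms sets.space_closed in \<open>auto simp: positive_def\<close>)

lemma hellinger2_sq_eq_wrt:
  assumes fin: "finite_measure \<mu>0" "finite_measure \<mu>1" and m: "sigma_finite_measure m"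
    and ac: "absolutely_continuous m \<mu>0" "absolutely_continuous m \<mu>1"
    and sets: "sets \<mu>0 = sets m" "sets \<mu>1 = sets m"
  shows "hellinger2_sq \<mu>0 \<mu>1 = hellinger2_sq_wrt m \<mu>0 \<mu>1"
proof -
  interpret m: sigma_finite_measure m by (rule m)
  interpret M0: finite_measure \<mu>0 by (rule fin)
  interpret M1: finite_measure \<mu>1 by (rule fin)
  define s where "s = measure_add \<mu>0 \<mu>1"
  have ss: "sets s = sets m" and sp: "space s = space \<mu>0"
    using sets by (auto simp: s_def)
  have es: "emeasure s A = emeasure \<mu>0 A + emeasure \<mu>1 A" if "A \<in> sets m" for A
    using emeasure_measure_add[of \<mu>0 \<mu>1 A] that sets by (simp add: s_def)
  interpret s: finite_measure s
  proof
    have "space s \<in> sets m" using ss by auto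
    moreover from this have "space \<mu>0 \<in> sets m" "space \<mu>1 \<in> sets m"
      using sets by (auto dest: sets_eq_imp_space_eq)
    ultimately show "emeasure s (space s) \<noteq> \<infinity>"
      by (simp add: es M0.emeasure_finite M1.emeasure_finite)
  qed
  have ac_s: "absolutely_continuous s \<mu>0" "absolutely_continuous s \<mu>1"
    using es ss sets by (auto simp: absolutely_continuous_def null_sets_def)
  have ac_m: "absolutely_continuous m s"
    using es ss ac sets by (auto simp: absolutely_continuous_def null_sets_def)
  define h where "h = RN_deriv m s"
  have hm [measurable]: "h \<in> borel_measurable m" by (simp add: h_def)
  have dh: "density m h = s"
    unfolding h_def by (rule m.density_RN_deriv[OF ac_m ss])
  have RN: "AE x in m. RN_deriv m \<nu> x = h x * RN_deriv s \<nu> x"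
    if \<nu>: "absolutely_continuous s \<nu>" "sets \<nu> = sets m" for \<nu>
  proof -
    have [measurable]: "RN_deriv s \<nu> \<in> borel_measurable m"
      using borel_measurable_RN_deriv[of s \<nu>] measurable_cong_sets[OF ss refl] by blast
    have "\<nu> = density s (RN_deriv s \<nu>)"
      using \<nu> ss by (intro s.density_RN_deriv[symmetric]) auto
    also have "\<dots> = density m (\<lambda>x. h x * RN_deriv s \<nu> x)"
      by (subst dh[symmetric], subst density_density_eq) auto
    finally have "density m (\<lambda>x. h x * RN_deriv s \<nu> x) = \<nu>" by simp
    from m.RN_deriv_unique[OF _ this] show ?thesis by (auto elim: eventually_mono)
  qed
  have hfin: "AE x in m. h x \<noteq> \<infinity>"
    unfolding h_def
    by (rule m.RN_deriv_finite[OF _ ac_m ss]) (rule s.sigma_finite_measure_axioms)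
  let ?F = "\<lambda>x. ennreal ((sqrt (enn2real (RN_deriv s \<mu>1 x)) - sqrt (enn2real (RN_deriv s \<mu>0 x)))\<^sup>2)"
  have Fm: "?F \<in> borel_measurable m"
    by (subst measurable_cong_sets[OF ss[symmetric] refl]) measurable
  have "hellinger2_sq \<mu>0 \<mu>1 = (\<integral>\<^sup>+ x. ?F x \<partial>s)"
    by (simp add: hellinger2_sq_def hellinger2_sq_wrt_def s_def)
  also have "\<dots> = (\<integral>\<^sup>+ x. h x * ?F x \<partial>m)"
    by (subst dh[symmetric], subst nn_integral_density) (use Fm in \<open>auto simp: dh\<close>)
  also have "\<dots> = hellinger2_sq_wrt m \<mu>0 \<mu>1"
    unfolding hellinger2_sq_wrt_def
  proof (rule nn_integral_cong_AE)
    show "AE x in m. h x * ?F x =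
      ennreal ((sqrt (enn2real (RN_deriv m \<mu>1 x)) - sqrt (enn2real (RN_deriv m \<mu>0 x)))\<^sup>2)"
      using RN[OF ac_s(1) sets(1)] RN[OF ac_s(2) sets(2)] hfin
    proof eventually_elim
      case (elim x)
      define r where "r = enn2real (h x)"
      have r: "h x = ennreal r" "r \<ge> 0"
        using elim by (auto simp: r_def ennreal_enn2real_if)
      show ?case
        unfolding elim(1,2) r(1)
        using r(2) by (simp add: enn2real_mult real_sqrt_mult ennreal_mult[symmetric]
            right_diff_distrib[symmetric] power_mult_distrib)
    qed
  qed
  finally show ?thesis .
qed

end

theory Submission
  imports Defs
begin

text \<open>
  The proof replaces the diffusion by its Euler scheme \<open>x \<mapsto> x - h \<nabla>U(x) + z\<close>, where \<open>z\<close> is a centred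
  Gaussian vector with variance \<open>2 h\<close> in each coordinate and \<open>h = t / k\<close>, establishes an entropy
  inequality for \<open>k\<close> steps of this chain by elementary means, and lets \<open>k \<rightarrow> \<infinity>\<close>.

  Let \<open>Q\<close> be the Markov operator of one step. Convexity of \<open>U\<close> makes \<open>\<nabla>U\<close> monotone, so a step without
  noise expands distances by a factor \<open>1 + O(h\<^sup>2)\<close> only. A Gaussian can be shifted by \<open>v\<close> at the
  price of a relative entropy \<open>|v|\<^sup>2 / (4 h)\<close>. Bridging the distance from \<open>y\<close> to \<open>x\<close> in \<open>k\<close> equal shares,
  one in each step, costs \<open>|x - y|\<^sup>2 / (4 k h)\<close>. This is the logarithmic Harnack inequality
  \<open>chain_log_harnack\<close>:
  \<open>Q\<^sup>k \<phi> (x) \<le> ln (Q\<^sup>k exp \<phi>) (y) + (1 + O(h)) |x - y|\<^sup>2 / (4 t)\<close>.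

  It is then integrated over \<open>y\<close> with respect to \<open>\<mu>\<close>. That \<open>\<mu>\<close> is invariant under the diffusion enters
  in a quantitative form for the chain: the joint density of two successive positions, started
  from \<open>\<mu>\<close>, is symmetric up to a factor \<open>exp R\<close> in which \<open>R\<close> is essentially the error of the
  trapezoidal rule for \<open>U\<close>. The mean of \<open>|R|\<close> is \<open>o(h)\<close> (\<open>reversal_exponent_mean_little_o\<close>), so the mean of
  \<open>Q\<^sup>k f\<close> under \<open>\<mu>\<close> exceeds that of a bounded function \<open>f \<ge> 0\<close> by at most \<open>k \<cdot> o(h) = o(1)\<close>
  (\<open>chain_almost_invariant\<close>).

  Since the noise is additive and the equation is read path by path, the Euler scheme converges along
  almost every path (\<open>euler_path_converges\<close>). In the limit, for bounded continuous \<open>\<phi>\<close>,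
  \<open>\<integral> \<phi> d(\<delta>\<^sub>x P\<^sub>t) \<le> ln (\<integral> exp \<phi> d\<mu>) + (\<integral> |x - y|\<^sup>2 d\<mu>(y)) / (4 t)\<close>. By density this extends to bounded
  measurable \<open>\<phi>\<close> and then bounds the relative entropy of \<open>\<delta>\<^sub>x P\<^sub>t\<close> with respect to \<open>\<mu>\<close>, which dominates
  the squared Hellinger distance (\<open>hellinger_le_entropy_bound\<close>). The integral of \<open>|x - y|\<^sup>2\<close> is the squared
  Wasserstein distance from \<open>\<delta>\<^sub>x\<close>, and the Hellinger distance dominates the total variation distance.
\<close>

section \<open>Gaussian measures\<close>

definition gauss_density :: "real \<Rightarrow> real ^ 'n \<Rightarrow> real" where
  "gauss_density s z = (\<Prod>i\<in>UNIV. normal_density 0 s (z $ i))"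

definition gauss :: "real \<Rightarrow> (real ^ 'n) measure" where
  "gauss s = density lborel (\<lambda>z. ennreal (gauss_density s z))"

lemma gauss_density_eq:
  fixes z :: "real ^ 'n"
  shows "gauss_density s z = (1 / sqrt (2 * pi * s\<^sup>2)) ^ CARD('n) * exp (- (norm z)\<^sup>2 / (2 * s\<^sup>2))"
proof -
  have "(\<Sum>i\<in>UNIV. - (z $ i)\<^sup>2 / (2 * s\<^sup>2)) = - (norm z)\<^sup>2 / (2 * s\<^sup>2)"
    by (simp add: norm_vec_def L2_set_def sum_nonneg sum_negf sum_divide_distrib)
  then show ?thesis
    unfolding gauss_density_def normal_density_def
    by (simp only: prod.distrib prod_constant exp_sum[symmetric] finite diff_zero)
qed

lemma gauss_density_nonneg: "0 \<le> gauss_density s z"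
  by (simp add: gauss_density_eq)

lemma gauss_density_measurable [measurable]:
  "gauss_density s \<in> borel_measurable borel"
  unfolding gauss_density_eq[abs_def] by measurable

lemma sets_gauss [simp, measurable_cong]: "sets (gauss s) = sets borel"
  and space_gauss [simp]: "space (gauss s) = UNIV"
  by (simp_all add: gauss_def)

text \<open>
  Tonelli's theorem for products of one-dimensional functions, with the factors indexed by the
  coordinates of the vector rather than by its basis vectors.
\<close>

lemma nn_integral_lborel_prod_vec:
  assumes [measurable]: "\<And>i. f i \<in> borel_measurable borel" and nn: "\<And>i x. (0::real) \<le> f i x"
  shows "(\<integral>\<^sup>+z. (\<Prod>i\<in>UNIV. ennreal (f i (z $ i))) \<partial>(lborel :: (real ^ 'n) measure)) = (\<Prod>i\<in>UNIV. \<integral>\<^sup>+x. f i x \<partial>lborel)"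
proof -
  have B: "Basis = (\<lambda>i::'n. axis i (1::real)) ` UNIV" by (auto simp: Basis_vec_def)
  have inj: "inj (\<lambda>i::'n. axis i (1::real))" by (auto simp: inj_on_def axis_eq_axis)
  define h where "h b = (\<lambda>x. ennreal (f (inv (\<lambda>i::'n. axis i (1::real)) b) x))" for b
  have h: "h (axis i 1) = (\<lambda>x. ennreal (f i x))" for i
    unfolding h_def by (simp add: inv_f_f[OF inj])
  have "(\<integral>\<^sup>+z. (\<Prod>b\<in>Basis. h b (z \<bullet> b)) \<partial>(lborel :: (real ^ 'n) measure)) = (\<Prod>b\<in>Basis. \<integral>\<^sup>+x. h b x \<partial>lborel)"
    by (rule nn_integral_lborel_prod) (auto simp: h_def)
  then show ?thesis
    unfolding B by (simp add: prod.reindex[OF inj] h inner_axis)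
qed

lemma nn_integral_normal_density: "0 < s \<Longrightarrow> (\<integral>\<^sup>+x. ennreal (normal_density 0 s x) \<partial>lborel) = 1"
  by (subst nn_integral_eq_integral) auto

lemma prob_space_gauss:
  assumes "0 < s" shows "prob_space (gauss s :: (real ^ 'n) measure)"
proof
  have "emeasure (gauss s :: (real ^ 'n) measure) (space (gauss s)) = (\<integral>\<^sup>+z. (\<Prod>i\<in>UNIV. ennreal (normal_density 0 s (z $ i))) \<partial>(lborel :: (real ^ 'n) measure))"
    by (simp add: gauss_def emeasure_density gauss_density_def[symmetric] prod_ennreal)
  also have "\<dots> = 1"
    using assms by (subst nn_integral_lborel_prod_vec) (auto simp: nn_integral_normal_density)
  finally show "emeasure (gauss s :: (real ^ 'n) measure) (space (gauss s)) = 1" .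
qed

lemma integrable_gauss_norm_sq:
  assumes s: "0 < s" shows "integrable (gauss s) (\<lambda>z :: real ^ 'n. (norm z)\<^sup>2)"
proof -
  have "integrable (gauss s) (\<lambda>z :: real ^ 'n. (z $ i)\<^sup>2)" for i
  proof (rule integrableI_bounded)
    define f where "f = (\<lambda>j x. normal_density 0 s x * (if j = i then x\<^sup>2 else 1))"
    have p: "(\<Prod>j\<in>UNIV. f j (z $ j)) = gauss_density s z * (z $ i)\<^sup>2" for z
      by (simp add: f_def gauss_density_def prod.distrib prod.delta)
    have "(\<integral>\<^sup>+z. ennreal (norm ((z $ i)\<^sup>2)) \<partial>gauss s) = (\<integral>\<^sup>+z. (\<Prod>j\<in>UNIV. ennreal (f j (z $ j))) \<partial>(lborel :: (real ^ 'n) measure))"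
      unfolding gauss_def
      by (subst nn_integral_density)
         (auto simp: prod_ennreal f_def gauss_density_def prod.distrib prod.delta ennreal_mult' prod_nonneg)
    also have "\<dots> = (\<Prod>j\<in>UNIV. \<integral>\<^sup>+x. f j x \<partial>lborel)"
      by (rule nn_integral_lborel_prod_vec) (auto simp: f_def)
    also have "\<dots> < \<infinity>"
    proof -
      have fin: "(\<integral>\<^sup>+x. f j x \<partial>lborel) < \<infinity>" for j
        using integrable_normal_moment[OF s, of 0 2] nn_integral_normal_density[OF s]
        by (cases "j = i") (auto simp: f_def nn_integral_eq_integral)
      have "(\<Prod>j\<in>S. \<integral>\<^sup>+x. f j x \<partial>lborel) < \<infinity>" if "finite S" for S
        using that by (induction S rule: finite_induct) (auto simp: ennreal_mult_less_top fin[simplified])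
      then show ?thesis by simp
    qed
    finally show "(\<integral>\<^sup>+z. ennreal (norm ((z $ i)\<^sup>2)) \<partial>(gauss s :: (real ^ 'n) measure)) < \<infinity>" .
  qed simp
  then have "integrable (gauss s) (\<lambda>z :: real ^ 'n. \<Sum>i\<in>UNIV. (z $ i)\<^sup>2)"
    by (rule Bochner_Integration.integrable_sum)
  then show ?thesis
    by (simp add: norm_vec_def L2_set_def sum_nonneg)
qed

lemma integrable_gauss_norm:
  assumes s: "0 < s" shows "integrable (gauss s) (\<lambda>z :: real ^ 'n. norm z)"
proof -
  interpret prob_space "gauss s :: (real ^ 'n) measure" by (rule prob_space_gauss[OF s])
  show ?thesis
  proof (rule Bochner_Integration.integrable_bound)
    show "integrable (gauss s) (\<lambda>z :: real ^ 'n. 1 + (norm z)\<^sup>2)"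
      by (intro Bochner_Integration.integrable_add integrable_const integrable_gauss_norm_sq s)
    have "x \<le> 1 + x\<^sup>2" if "0 \<le> x" for x :: real
      using zero_le_power2[of "x - 1"] that by (simp add: power2_diff)
    then show "AE z :: real ^ 'n in gauss s. norm (norm z) \<le> norm (1 + (norm z)\<^sup>2)"
      by simp
  qed simp
qed

lemma integrable_gauss_inner:
  assumes s: "0 < s" shows "integrable (gauss s) (\<lambda>z :: real ^ 'n. a \<bullet> z)"
  by (rule Bochner_Integration.integrable_bound[OF integrable_mult_right[OF integrable_gauss_norm[OF s], of "norm a"]])
     (auto simp: Cauchy_Schwarz_ineq2)

lemma integral_gauss_inner:
  fixes a :: "real ^ 'n" assumes s: "0 < s" shows "(\<integral>z. (a \<bullet> z) \<partial>gauss s) = 0"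
proof -
  have "distr lborel borel (\<lambda>z :: real ^ 'n. - z) = lborel"
    by (subst lborel_affine[of "-1" 0]) (auto simp: density_1 one_ennreal_def[symmetric])
  then have "(\<integral>z. gauss_density s z * (a \<bullet> z) \<partial>lborel) = (\<integral>z. gauss_density s z * (a \<bullet> z) \<partial>distr lborel borel (\<lambda>z :: real ^ 'n. - z))"
    by simp
  also have "\<dots> = - (\<integral>z. gauss_density s z * (a \<bullet> z) \<partial>lborel)"
    by (subst integral_distr) (auto simp: gauss_density_eq)
  finally show ?thesis
    unfolding gauss_def by (subst integral_density) (auto simp: gauss_density_nonneg)
qed

lemma gauss_scale:
  assumes "0 < s"
  shows "gauss s = distr (gauss 1) borel (\<lambda>z :: real ^ 'n. s *\<^sub>R z)"
proof (rule measure_eqI)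
  fix A assume "A \<in> sets (gauss s :: (real ^ 'n) measure)"
  then have [measurable]: "A \<in> sets borel" by simp
  have d: "gauss_density s (s *\<^sub>R z) * s ^ CARD('n) = gauss_density 1 z" for z :: "real ^ 'n"
    using assms by (simp add: gauss_density_eq power_divide real_sqrt_mult power_mult_distrib field_simps)
  have L: "lborel = density (distr lborel borel (\<lambda>z :: real ^ 'n. s *\<^sub>R z)) (\<lambda>_. \<bar>s\<bar> ^ CARD('n))"
    using lborel_affine[of s "0 :: real ^ 'n"] assms by simp
  have "emeasure (gauss s) A = (\<integral>\<^sup>+z. ennreal (gauss_density s z) * indicator A z \<partial>lborel)"
    by (simp add: gauss_def emeasure_density)
  also have "\<dots> = (\<integral>\<^sup>+z. ennreal (gauss_density s (s *\<^sub>R z) * s ^ CARD('n)) * indicator A (s *\<^sub>R z) \<partial>lborel)"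
    using assms
    by (subst L, subst nn_integral_density, simp, simp, subst nn_integral_distr)
       (auto simp: ennreal_mult gauss_density_nonneg mult_ac)
  also have "\<dots> = emeasure (distr (gauss 1) borel (\<lambda>z :: real ^ 'n. s *\<^sub>R z)) A"
    unfolding d gauss_def using measurable_sets_borel[of "\<lambda>z :: real ^ 'n. s *\<^sub>R z" borel A]
    by (subst emeasure_distr, simp, simp, subst emeasure_density) (auto intro!: nn_integral_cong split: split_indicator)
  finally show "emeasure (gauss s) A = \<dots>" .
qed simp

text \<open>
  The Cameron--Martin formula for a constant shift; the exponent is linear in \<open>z\<close> up to a constant,
  so that its mean under the centred Gaussian is explicit.
\<close>

lemma gauss_density_shift:
  assumes "0 < s"
  shows "gauss_density s (z + d) = gauss_density s z * exp (- (d \<bullet> z) / s\<^sup>2 - (norm d)\<^sup>2 / (2 * s\<^sup>2))"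
proof -
  have "- (norm (z + d))\<^sup>2 / (2 * s\<^sup>2) = - (norm z)\<^sup>2 / (2 * s\<^sup>2) + (- (d \<bullet> z) / s\<^sup>2 - (norm d)\<^sup>2 / (2 * s\<^sup>2))"
    using assms by (simp add: power2_norm_eq_inner inner_add_left inner_add_right inner_commute field_simps)
  then show ?thesis
    unfolding gauss_density_eq by (simp add: exp_add[symmetric])
qed

text \<open>
  This one-step estimate is where the noise regularizes. Rewriting the mean of \<open>exp G\<close> around \<open>b\<close>
  as a mean around \<open>a\<close> costs the Cameron--Martin density, and Jensen's inequality for \<open>exp\<close> leaves
  of that density only its expected logarithm \<open>- |a - b|\<^sup>2 / (2 s\<^sup>2)\<close>, which is minus the relative
  entropy of one Gaussian with respect to the other.
\<close>

lemma gauss_shift_log_harnack: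
  fixes G :: "real ^ 'n \<Rightarrow> real"
  assumes s: "0 < s" and [measurable]: "G \<in> borel_measurable borel" and B: "\<And>x. \<bar>G x\<bar> \<le> B"
  shows "(\<integral>z. G (a + z) \<partial>gauss s) \<le> ln (\<integral>z. exp (G (b + z)) \<partial>gauss s) + (norm (a - b))\<^sup>2 / (2 * s\<^sup>2)"
proof -
  interpret prob_space "gauss s :: (real ^ 'n) measure" by (rule prob_space_gauss[OF s])
  define d where "d = a - b"
  define c where "c = (norm d)\<^sup>2 / (2 * s\<^sup>2)"
  define W where "W z = G (a + z) - (d \<bullet> z) / s\<^sup>2 - c" for z
  have [measurable]: "W \<in> borel_measurable borel" unfolding W_def by measurable
  have iG: "integrable (gauss s) (\<lambda>z. G (a + z))"
    by (rule integrable_const_bound[where B = B]) (auto simp: B)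
  have iE: "integrable (gauss s) (\<lambda>z. exp (G (b + z)))"
    by (rule integrable_const_bound[where B = "exp B"]) (use B in \<open>auto simp: abs_le_iff\<close>)
  have iW: "integrable (gauss s) W"
    unfolding W_def using iG integrable_gauss_inner[OF s, of d] by auto
  have EW: "expectation W = (\<integral>z. G (a + z) \<partial>gauss s) - c"
    unfolding W_def using iG integrable_gauss_inner[OF s, of d] integral_gauss_inner[OF s, of d] prob_space
    by (simp add: space_gauss)
  let ?k = "\<lambda>z. gauss_density s z * exp (G (b + z))"
  \<comment> \<open>\<open>exp W\<close> is the integrand around \<open>b\<close>, seen through the change of variables \<open>z \<mapsto> d + z\<close>.\<close>
  have tr: "gauss_density s z * exp (W z) = ?k (d + z)" for z
  proof -
    have "W z = G (b + (d + z)) + (- (d \<bullet> z) / s\<^sup>2 - (norm d)\<^sup>2 / (2 * s\<^sup>2))"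
      by (simp add: W_def c_def d_def)
    then show ?thesis
      using gauss_density_shift[OF s, of z d] by (simp only: exp_add add.commute[of d z] mult_ac)
  qed
  have ik: "integrable lborel ?k"
    using iE unfolding gauss_def by (subst (asm) integrable_density) (auto simp: gauss_density_nonneg)
  have ik': "integrable lborel (\<lambda>z. ?k (d + z))"
    using ik by (subst (asm) lborel_distr_plus[of d, symmetric], subst (asm) integrable_distr_eq) auto
  have Ik: "(\<integral>z. ?k (d + z) \<partial>lborel) = (\<integral>z. ?k z \<partial>lborel)"
    by (subst (2) lborel_distr_plus[of d, symmetric], subst integral_distr) auto
  have ieW: "integrable (gauss s) (\<lambda>z. exp (W z))"
    using ik' unfolding tr[symmetric] gauss_def by (subst integrable_density) (auto simp: gauss_density_nonneg)
  have EeW: "expectation (\<lambda>z. exp (W z)) = (\<integral>z. exp (G (b + z)) \<partial>gauss s)"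
    using Ik unfolding tr[symmetric] gauss_def by (subst (1 2) integral_density) (auto simp: gauss_density_nonneg)
  have cv: "convex_on UNIV (exp :: real \<Rightarrow> real)" by (rule exp_convex)
  have J: "exp (expectation W) \<le> expectation (\<lambda>z. exp (W z))"
    by (rule jensens_inequality[OF iW _ _ ieW cv]) auto
  then have "expectation W \<le> ln (expectation (\<lambda>z. exp (W z)))"
    by (metis exp_gt_zero ln_exp ln_mono order.strict_trans2)
  then show ?thesis unfolding EW EeW c_def d_def by simp
qed

section \<open>Markov chains with Gaussian noise\<close>

text \<open>
  The Markov operator of one step \<open>x \<mapsto> g x + z\<close> with centred Gaussian noise \<open>z\<close> of variance \<open>s\<^sup>2\<close> in
  each coordinate.
\<close>

definition step_op :: "(real ^ 'n \<Rightarrow> real ^ 'n) \<Rightarrow> real \<Rightarrow> (real ^ 'n \<Rightarrow> real) \<Rightarrow> real ^ 'n \<Rightarrow> real" where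
  "step_op g s \<phi> x = (\<integral>z. \<phi> (g x + z) \<partial>gauss s)"

lemma step_op_measurable [measurable (raw)]:
  assumes s: "0 < s" and [measurable]: "g \<in> borel_measurable borel" "\<phi> \<in> borel_measurable borel"
  shows "step_op g s \<phi> \<in> borel_measurable borel"
proof -
  interpret prob_space "gauss s :: (real ^ 'b) measure" by (rule prob_space_gauss[OF s])
  show ?thesis unfolding step_op_def by measurable
qed

lemma integrable_gauss_bounded:
  fixes \<phi> :: "real ^ 'n \<Rightarrow> real"
  assumes s: "0 < s" and [measurable]: "\<phi> \<in> borel_measurable borel"
    and bd: "\<And>x. l \<le> \<phi> x" "\<And>x. \<phi> x \<le> u"
  shows "integrable (gauss s) (\<lambda>z. \<phi> (a + z))"
proof -
  interpret prob_space "gauss s :: (real ^ 'n) measure" by (rule prob_space_gauss[OF s])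
  have "\<bar>\<phi> x\<bar> \<le> \<bar>l\<bar> + \<bar>u\<bar>" for x using bd[of x] by linarith
  then show ?thesis
    by (intro integrable_const_bound[where B = "\<bar>l\<bar> + \<bar>u\<bar>"]) auto
qed

lemma step_op_bounds:
  assumes s: "0 < s" and [measurable]: "\<phi> \<in> borel_measurable borel"
    and bd: "\<And>x. l \<le> \<phi> x" "\<And>x. \<phi> x \<le> u"
  shows "l \<le> step_op g s \<phi> x" "step_op g s \<phi> x \<le> u"
proof -
  interpret prob_space "gauss s :: (real ^ 'n) measure" by (rule prob_space_gauss[OF s])
  note i = integrable_gauss_bounded[OF s assms(2) bd]
  show "l \<le> step_op g s \<phi> x" unfolding step_op_def
    by (rule integral_ge_const[OF i]) (simp add: bd)
  show "step_op g s \<phi> x \<le> u" unfolding step_op_def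
    by (rule integral_le_const[OF i]) (simp add: bd)
qed

lemma step_op_iterate:
  assumes s: "0 < s" and g [measurable]: "g \<in> borel_measurable borel" and \<phi> [measurable]: "\<phi> \<in> borel_measurable borel"
    and bd: "\<And>x. l \<le> \<phi> x" "\<And>x. \<phi> x \<le> u"
  shows step_op_iterate_measurable: "(step_op g s ^^ k) \<phi> \<in> borel_measurable borel"
    and step_op_iterate_lower: "l \<le> (step_op g s ^^ k) \<phi> x"
    and step_op_iterate_upper: "(step_op g s ^^ k) \<phi> x \<le> u"
proof -
  have "(step_op g s ^^ k) \<phi> \<in> borel_measurable borel \<and> (\<forall>x. l \<le> (step_op g s ^^ k) \<phi> x \<and> (step_op g s ^^ k) \<phi> x \<le> u)"
  proof (induction k)
    case 0 then show ?case using bd by simp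
  next
    case (Suc k) then show ?case
      using step_op_measurable[OF s g, of "(step_op g s ^^ k) \<phi>"]
        step_op_bounds[OF s, of "(step_op g s ^^ k) \<phi>" l u] by simp
  qed
  then show "(step_op g s ^^ k) \<phi> \<in> borel_measurable borel" "l \<le> (step_op g s ^^ k) \<phi> x" "(step_op g s ^^ k) \<phi> x \<le> u"
    by auto
qed

text \<open>
  The logarithmic Harnack inequality for the chain, with a constant decaying like the inverse of
  the number of steps. Bridging the distance of two starting points in a single step by a shift of the
  noise costs \<open>|x - y|\<^sup>2 / (2 s\<^sup>2)\<close>. If each of \<open>k\<close> steps bridges an equal share instead, the
  costs add up to \<open>k \<cdot> (|x - y| / k)\<^sup>2 / (2 s\<^sup>2) = |x - y|\<^sup>2 / (2 k s\<^sup>2)\<close>. The factor \<open>q\<close> accounts for an expansion of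
  distances by \<open>g\<close>.
\<close>

lemma chain_log_harnack:
  fixes g :: "real ^ 'n \<Rightarrow> real ^ 'n" and \<phi> :: "real ^ 'n \<Rightarrow> real" and s :: real
  assumes s: "0 < s" and g: "g \<in> borel_measurable borel"
    and lip: "\<And>x y. (norm (g x - g y))\<^sup>2 \<le> q * (norm (x - y))\<^sup>2" and q: "1 \<le> q"
    and \<phi> [measurable]: "\<phi> \<in> borel_measurable borel" and B: "\<And>x. \<bar>\<phi> x\<bar> \<le> B"
  shows "(step_op g s ^^ Suc k) \<phi> x
    \<le> ln ((step_op g s ^^ Suc k) (\<lambda>y. exp (\<phi> y)) y) + q ^ Suc k * (norm (x - y))\<^sup>2 / (2 * real (Suc k) * s\<^sup>2)"
proof (induction k arbitrary: x y)
  case 0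
  have "(norm (g x - g y))\<^sup>2 / (2 * s\<^sup>2) \<le> q * (norm (x - y))\<^sup>2 / (2 * s\<^sup>2)"
    using lip[of x y] s by (intro divide_right_mono) auto
  moreover have "(\<integral>z. \<phi> (g x + z) \<partial>gauss s) \<le> ln (\<integral>z. exp (\<phi> (g y + z)) \<partial>gauss s) + (norm (g x - g y))\<^sup>2 / (2 * s\<^sup>2)"
    by (rule gauss_shift_log_harnack[OF s \<phi>]) (rule B)
  ultimately show ?case
    by (simp add: step_op_def)
next
  case (Suc k)
  have bd: "- B \<le> \<phi> x" "\<phi> x \<le> B" and bde: "exp (- B) \<le> exp (\<phi> x)" "exp (\<phi> x) \<le> exp B" for x
    using B[of x] by (auto simp: abs_le_iff)
  define F where "F = (step_op g s ^^ Suc k) \<phi>"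
  define E where "E = (step_op g s ^^ Suc k) (\<lambda>y. exp (\<phi> y))"
  define G where "G y = ln (E y)" for y
  define \<kappa> where "\<kappa> = q ^ Suc k / (2 * real (Suc k) * s\<^sup>2)"
  have \<kappa>: "0 \<le> \<kappa>" using q by (simp add: \<kappa>_def)
  have Fm [measurable]: "F \<in> borel_measurable borel"
    unfolding F_def by (rule step_op_iterate_measurable[OF s g \<phi> bd])
  have Fb: "- B \<le> F x" "F x \<le> B" for x
    unfolding F_def by (rule step_op_iterate_lower[OF s g \<phi> bd] step_op_iterate_upper[OF s g \<phi> bd])+
  have em: "(\<lambda>y. exp (\<phi> y)) \<in> borel_measurable borel" by simp
  have Em [measurable]: "E \<in> borel_measurable borel"
    unfolding E_def by (rule step_op_iterate_measurable[OF s g em bde])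
  have Eb: "exp (- B) \<le> E x" "E x \<le> exp B" for x
    unfolding E_def by (rule step_op_iterate_lower[OF s g em bde] step_op_iterate_upper[OF s g em bde])+
  have Epos: "0 < E x" for x using Eb(1)[of x] exp_gt_zero[of "- B"] by linarith
  have Gm [measurable]: "G \<in> borel_measurable borel" unfolding G_def by measurable
  have eG: "exp (G x) = E x" for x using Epos by (simp add: G_def)
  have GB: "- B \<le> G x" "G x \<le> B" for x
    using Eb[of x] unfolding eG[symmetric] by auto
  have IH: "F u \<le> G w + \<kappa> * (norm (u - w))\<^sup>2" for u w
    using Suc[of u w] by (simp add: F_def G_def E_def \<kappa>_def)
  define a b where "a = g x" and "b = g y"
  \<comment> \<open>Of the \<open>k + 2\<close> steps that remain, the present one covers an equal share of the distance:
      the noise moves the starting point \<open>b\<close> to \<open>b'\<close>, and the induction hypothesis covers the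
      distance from \<open>b'\<close> to \<open>a\<close>.\<close>
  define \<theta> where "\<theta> = 1 / real (Suc (Suc k))"
  define b' where "b' = b + \<theta> *\<^sub>R (a - b)"
  interpret prob_space "gauss s :: (real ^ 'n) measure" by (rule prob_space_gauss[OF s])
  have "step_op g s F x = (\<integral>z. F (a + z) \<partial>gauss s)"
    by (simp add: step_op_def a_def)
  also have "\<dots> \<le> (\<integral>z. G (b' + z) + \<kappa> * (norm (a - b'))\<^sup>2 \<partial>gauss s)"
  proof (rule integral_mono)
    show "integrable (gauss s) (\<lambda>z. F (a + z))" by (rule integrable_gauss_bounded[OF s Fm Fb])
    show "integrable (gauss s) (\<lambda>z. G (b' + z) + \<kappa> * (norm (a - b'))\<^sup>2)"
      by (intro Bochner_Integration.integrable_add integrable_const integrable_gauss_bounded[OF s Gm GB])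
    show "F (a + z) \<le> G (b' + z) + \<kappa> * (norm (a - b'))\<^sup>2" for z
      using IH[of "a + z" "b' + z"] by simp
  qed
  also have "\<dots> = (\<integral>z. G (b' + z) \<partial>gauss s) + \<kappa> * (norm (a - b'))\<^sup>2"
    using integrable_gauss_bounded[OF s Gm GB, of b'] prob_space by simp
  also have "(\<integral>z. G (b' + z) \<partial>gauss s) \<le> ln (\<integral>z. exp (G (b + z)) \<partial>gauss s) + (norm (b' - b))\<^sup>2 / (2 * s\<^sup>2)"
    by (rule gauss_shift_log_harnack[OF s Gm, of B]) (use GB in \<open>auto simp: abs_le_iff minus_le_iff\<close>)
  also have "(\<integral>z. exp (G (b + z)) \<partial>gauss s) = step_op g s E y"
    by (simp add: step_op_def eG b_def)
  finally have 1: "step_op g s F x \<le> ln (step_op g s E y) + ((norm (b' - b))\<^sup>2 / (2 * s\<^sup>2) + \<kappa> * (norm (a - b'))\<^sup>2)"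
    by simp
  have n1: "(norm (b' - b))\<^sup>2 = \<theta>\<^sup>2 * (norm (a - b))\<^sup>2"
    by (simp add: b'_def power_mult_distrib)
  have "a - b' = (1 - \<theta>) *\<^sub>R (a - b)" by (simp add: b'_def algebra_simps)
  then have n2: "(norm (a - b'))\<^sup>2 = (1 - \<theta>)\<^sup>2 * (norm (a - b))\<^sup>2"
    by (simp add: power_mult_distrib)
  define c where "c = q ^ Suc k"
  define r where "r = real (Suc k)"
  have r: "r > 0" "real (Suc (Suc k)) = r + 1" and c: "1 \<le> c"
    using one_le_power[OF q, of "Suc k"] by (auto simp: r_def c_def)
  have "\<theta>\<^sup>2 / (2 * s\<^sup>2) + \<kappa> * (1 - \<theta>)\<^sup>2 = (1 + c * r) / (2 * s\<^sup>2 * (r + 1)\<^sup>2)"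
    using r s unfolding \<theta>_def \<kappa>_def r(2) c_def[symmetric] r_def[symmetric]
    by (simp add: field_simps power2_eq_square) (simp add: add_divide_distrib)
  also have "\<dots> \<le> (c + c * r) / (2 * s\<^sup>2 * (r + 1)\<^sup>2)"
    using c s r by (intro divide_right_mono) auto
  also have "\<dots> = c / (2 * (r + 1) * s\<^sup>2)"
  proof -
    have eqs: "c + c * r = c * (r + 1)" "2 * s\<^sup>2 * (r + 1)\<^sup>2 = (2 * (r + 1) * s\<^sup>2) * (r + 1)"
      by (simp_all add: power2_eq_square algebra_simps)
    show ?thesis unfolding eqs by (rule nonzero_mult_divide_mult_cancel_right) (use r in linarith)
  qed
  finally have "(\<theta>\<^sup>2 / (2 * s\<^sup>2) + \<kappa> * (1 - \<theta>)\<^sup>2) * (norm (a - b))\<^sup>2 \<le> c / (2 * (r + 1) * s\<^sup>2) * (q * (norm (x - y))\<^sup>2)"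
    using lip[of x y] c r s q by (intro mult_mono) (auto simp: a_def b_def)
  then have 2: "(norm (b' - b))\<^sup>2 / (2 * s\<^sup>2) + \<kappa> * (norm (a - b'))\<^sup>2
      \<le> q ^ Suc (Suc k) * (norm (x - y))\<^sup>2 / (2 * real (Suc (Suc k)) * s\<^sup>2)"
    unfolding n1 n2 r(2) c_def by (simp add: field_simps)
  have eqs: "(step_op g s ^^ Suc (Suc k)) \<phi> x = step_op g s F x"
    "(step_op g s ^^ Suc (Suc k)) (\<lambda>y. exp (\<phi> y)) y = step_op g s E y"
    by (simp_all add: F_def E_def)
  show ?case unfolding eqs by (rule order_trans[OF 1 add_left_mono[OF 2]])
qed

section \<open>Potentials with monotone Lipschitz gradient\<close>

lemma has_derivative_gradient:
  fixes U :: "real ^ 'n \<Rightarrow> real"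
  assumes "U differentiable (at x)"
  shows "(U has_derivative (\<lambda>h. h \<bullet> gradient U x)) (at x)"
proof -
  obtain f' where f': "(U has_derivative f') (at x)"
    using assms by (auto simp: differentiable_def)
  then interpret f': bounded_linear f' by (rule has_derivative_bounded_linear)
  define D where "D = (\<Sum>b\<in>Basis. f' b *\<^sub>R b)"
  have "f' h = h \<bullet> D" for h
  proof -
    have "f' h = f' (\<Sum>b\<in>Basis. (h \<bullet> b) *\<^sub>R b)" by (simp add: euclidean_representation)
    also have "\<dots> = h \<bullet> D"
      by (simp add: D_def f'.sum f'.scaleR inner_sum_right mult.commute)
    finally show ?thesis .
  qed
  then have "f' = (\<lambda>h. h \<bullet> D)" by auto
  then have D: "GDERIV U x :> D" using f' by (simp add: gderiv_def)
  have "E = D" if "GDERIV U x :> E" for E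
    using has_derivative_unique[OF that[unfolded gderiv_def] D[unfolded gderiv_def]]
    by (metis vector_eq_ldot)
  then have "gradient U x = D" unfolding gradient_def using D by (rule the_equality[rotated])
  with D show ?thesis by (simp add: gderiv_def)
qed

lemma DERIV_along_line:
  fixes U :: "real ^ 'n \<Rightarrow> real"
  assumes "\<And>x. U differentiable (at x)"
  shows "((\<lambda>r. U (x + r *\<^sub>R d)) has_real_derivative (d \<bullet> gradient U (x + r *\<^sub>R d))) (at r)"
proof -
  have l: "((\<lambda>r. x + r *\<^sub>R d) has_derivative (\<lambda>h. h *\<^sub>R d)) (at r)"
    by (auto intro!: derivative_eq_intros)
  have "((\<lambda>r. U (x + r *\<^sub>R d)) has_derivative (\<lambda>h. (h *\<^sub>R d) \<bullet> gradient U (x + r *\<^sub>R d))) (at r)"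
    by (rule has_derivative_compose[OF l has_derivative_gradient[OF assms]])
  then show ?thesis by (simp add: has_field_derivative_def mult_commute_abs)
qed

text \<open>
  A positive semidefinite Hessian is the nonnegativity of the derivative of
  \<open>r \<mapsto> v \<bullet> \<nabla>U(y + r v)\<close> along every segment.
\<close>

lemma gradient_monotone:
  fixes U :: "real ^ 'n \<Rightarrow> real"
  assumes d: "\<And>x. gradient U differentiable (at x)"
    and psd: "\<And>x v. 0 \<le> v \<bullet> (hessian U x *v v)"
  shows "0 \<le> (x - y) \<bullet> (gradient U x - gradient U y)"
proof -
  define v where "v = x - y"
  define D where "D z = frechet_derivative (gradient U) (at z)" for z
  have D: "(gradient U has_derivative D z) (at z)" for z
    unfolding D_def by (rule iffD1[OF frechet_derivative_works d])
  have "D z v = hessian U z *v v" for z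
  proof -
    have "linear (D z)" using D by (rule has_derivative_linear)
    then show ?thesis by (simp add: hessian_def D_def[symmetric] matrix_works linear_def scalar_mult_eq_scaleR[abs_def])
  qed
  then have nn: "0 \<le> v \<bullet> D z v" for z using psd by simp
  have "v \<bullet> gradient U (y + 0 *\<^sub>R v) \<le> v \<bullet> gradient U (y + 1 *\<^sub>R v)"
  proof (rule DERIV_nonneg_imp_nondecreasing[of 0 1 "\<lambda>r. v \<bullet> gradient U (y + r *\<^sub>R v)"])
    fix r :: real
    have l: "((\<lambda>r. y + r *\<^sub>R v) has_derivative (\<lambda>h. h *\<^sub>R v)) (at r)"
      by (auto intro!: derivative_eq_intros)
    have "((\<lambda>r. v \<bullet> gradient U (y + r *\<^sub>R v)) has_derivative (\<lambda>h. v \<bullet> D (y + r *\<^sub>R v) (h *\<^sub>R v))) (at r)"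
      by (rule has_derivative_inner_right[OF has_derivative_compose[OF l D]])
    then have "((\<lambda>r. v \<bullet> gradient U (y + r *\<^sub>R v)) has_real_derivative (v \<bullet> D (y + r *\<^sub>R v) v)) (at r)"
      using linear_cmul[OF has_derivative_linear[OF D]]
      by (simp add: has_field_derivative_def mult_commute_abs)
    with nn show "\<exists>y'. ((\<lambda>r. v \<bullet> gradient U (y + r *\<^sub>R v)) has_real_derivative y') (at r) \<and> 0 \<le> y'"
      by blast
  qed simp
  then show ?thesis by (simp add: v_def inner_diff_right)
qed

text \<open>
  The trapezoidal rule for \<open>U\<close> along a segment is exact for quadratic functions, so its error is
  governed by the deviation of \<open>\<nabla>U\<close> from an affine function. The choice \<open>H = 0\<close> gives a
  global quadratic bound for a Lipschitz gradient, while the derivative of \<open>\<nabla>U\<close> at \<open>x\<close> gives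
  an error that is small compared with \<open>|d|\<^sup>2\<close>.
\<close>

lemma trapezoid_error_bound:
  fixes U :: "real ^ 'n \<Rightarrow> real"
  assumes U: "\<And>x. U differentiable (at x)" and H: "linear H"
    and e: "\<And>w. norm w \<le> norm d \<Longrightarrow> norm (gradient U (x + w) - gradient U x - H w) \<le> \<epsilon> * norm w"
    and \<epsilon>: "0 \<le> \<epsilon>"
  shows "\<bar>U (x + d) - U x - (d \<bullet> (gradient U x + gradient U (x + d))) / 2\<bar> \<le> 2 * \<epsilon> * (norm d)\<^sup>2"
proof -
  define \<phi> where "\<phi> r = U (x + r *\<^sub>R d) - r * (d \<bullet> gradient U x) - r\<^sup>2 / 2 * (d \<bullet> H d)" for r
  define \<phi>' where "\<phi>' r = d \<bullet> (gradient U (x + r *\<^sub>R d) - gradient U x - H (r *\<^sub>R d))" for r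
  have der: "(\<phi> has_real_derivative \<phi>' r) (at r)" for r
    unfolding \<phi>_def \<phi>'_def
    by (rule derivative_eq_intros DERIV_along_line[OF U] | simp)+
       (simp add: linear_cmul[OF H] inner_diff_right)
  obtain r where r: "0 < r" "r < 1" "\<phi> 1 - \<phi> 0 = (1 - 0) * \<phi>' r"
    using MVT2[of 0 1 \<phi> \<phi>'] der by auto
  have "\<bar>\<phi>' r\<bar> \<le> norm d * (\<epsilon> * norm (r *\<^sub>R d))"
    unfolding \<phi>'_def using r mult_right_mono[of r 1 "norm d"]
    by (intro order_trans[OF Cauchy_Schwarz_ineq2] mult_left_mono e) auto
  also have "\<dots> = r * (\<epsilon> * (norm d)\<^sup>2)"
    using r by (simp add: power2_eq_square)
  also have "\<dots> \<le> 1 * (\<epsilon> * (norm d)\<^sup>2)"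
    using r \<epsilon> by (intro mult_right_mono) auto
  finally have 1: "\<bar>\<phi> 1 - \<phi> 0\<bar> \<le> \<epsilon> * (norm d)\<^sup>2" using r by simp
  have "\<bar>d \<bullet> (gradient U (x + d) - gradient U x - H d)\<bar> \<le> norm d * (\<epsilon> * norm d)"
    by (intro order_trans[OF Cauchy_Schwarz_ineq2] mult_left_mono e) auto
  then have 2: "\<bar>d \<bullet> (gradient U (x + d) - gradient U x - H d)\<bar> \<le> \<epsilon> * (norm d)\<^sup>2"
    by (simp add: power2_eq_square mult_ac)
  have "U (x + d) - U x - (d \<bullet> (gradient U x + gradient U (x + d))) / 2
      = (\<phi> 1 - \<phi> 0) - (d \<bullet> (gradient U (x + d) - gradient U x - H d)) / 2"
    by (simp add: \<phi>_def inner_diff_right inner_add_right field_simps)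
  moreover have "0 \<le> \<epsilon> * (norm d)\<^sup>2" using \<epsilon> by simp
  ultimately show ?thesis using 1 2 by linarith
qed

lemma trapezoid_error_lipschitz:
  fixes U :: "real ^ 'n \<Rightarrow> real"
  assumes U: "\<And>x. U differentiable (at x)" and L: "L-lipschitz_on UNIV (gradient U)"
  shows "\<bar>U (x + d) - U x - (d \<bullet> (gradient U x + gradient U (x + d))) / 2\<bar> \<le> 2 * L * (norm d)\<^sup>2"
proof (rule trapezoid_error_bound[OF U, of "\<lambda>_. 0"])
  show "norm (gradient U (x + w) - gradient U x - 0) \<le> L * norm w" for w
    using lipschitz_onD[OF L, of "x + w" x] by (simp add: dist_norm)
qed (use lipschitz_on_nonneg[OF L] in \<open>auto intro: linear_zero\<close>)

lemma trapezoid_error_little_o: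
  fixes U :: "real ^ 'n \<Rightarrow> real"
  assumes U: "\<And>x. U differentiable (at x)" and d: "gradient U differentiable (at x)" and \<epsilon>: "0 < \<epsilon>"
  shows "\<exists>\<delta>>0. \<forall>d. norm d < \<delta> \<longrightarrow>
    \<bar>U (x + d) - U x - (d \<bullet> (gradient U x + gradient U (x + d))) / 2\<bar> \<le> 2 * \<epsilon> * (norm d)\<^sup>2"
proof -
  obtain H where H: "(gradient U has_derivative H) (at x)" using d by (auto simp: differentiable_def)
  then obtain \<delta> where \<delta>: "\<delta> > 0" "\<And>y. norm (y - x) < \<delta> \<Longrightarrow> norm (gradient U y - gradient U x - H (y - x)) \<le> \<epsilon> * norm (y - x)"
    using \<epsilon> unfolding has_derivative_at_alt by blast
  show ?thesis
  proof (intro exI[of _ \<delta>] conjI allI impI \<delta>(1))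
    fix d :: "real ^ 'n" assume d: "norm d < \<delta>"
    show "\<bar>U (x + d) - U x - (d \<bullet> (gradient U x + gradient U (x + d))) / 2\<bar> \<le> 2 * \<epsilon> * (norm d)\<^sup>2"
    proof (rule trapezoid_error_bound[OF U has_derivative_linear[OF H]])
      show "norm (gradient U (x + w) - gradient U x - H w) \<le> \<epsilon> * norm w" if "norm w \<le> norm d" for w
        using \<delta>(2)[of "x + w"] that d by simp
    qed (use \<epsilon> in simp)
  qed
qed

definition euler_map :: "(real ^ 'n \<Rightarrow> real) \<Rightarrow> real \<Rightarrow> real ^ 'n \<Rightarrow> real ^ 'n" where
  "euler_map U h x = x - h *\<^sub>R gradient U x"

text \<open>
  Monotonicity of the gradient makes the cross term in the expansion of the square nonpositive. The
  excess over \<open>1\<close> is quadratic in \<open>h\<close> and disappears when \<open>t / h\<close> steps are composed and \<open>h \<rightarrow> 0\<close>.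
\<close>

lemma euler_map_lipschitz:
  assumes mono: "\<And>x y. 0 \<le> (x - y) \<bullet> (gradient U x - gradient U y)"
    and L: "L-lipschitz_on UNIV (gradient U)" and h: "0 \<le> h"
  shows "(norm (euler_map U h x - euler_map U h y))\<^sup>2 \<le> (1 + h\<^sup>2 * L\<^sup>2) * (norm (x - y))\<^sup>2"
proof -
  define D where "D = gradient U x - gradient U y"
  have e: "euler_map U h x - euler_map U h y = (x - y) - h *\<^sub>R D"
    by (simp add: euler_map_def D_def algebra_simps)
  have "norm D \<le> L * norm (x - y)" using lipschitz_onD[OF L, of x y] by (simp add: dist_norm D_def)
  then have "(norm D)\<^sup>2 \<le> L\<^sup>2 * (norm (x - y))\<^sup>2"
    using power_mono[of "norm D" "L * norm (x - y)" 2] by (simp add: power_mult_distrib)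
  then have n: "h\<^sup>2 * (norm D)\<^sup>2 \<le> h\<^sup>2 * (L\<^sup>2 * (norm (x - y))\<^sup>2)"
    by (intro mult_left_mono) auto
  have "(norm (euler_map U h x - euler_map U h y))\<^sup>2 = (norm (x - y))\<^sup>2 - 2 * h * ((x - y) \<bullet> D) + h\<^sup>2 * (norm D)\<^sup>2"
    unfolding e dot_norm_neg[of "x - y" "h *\<^sub>R D", unfolded inner_scaleR_right]
    using dot_norm_neg[of "x - y" "h *\<^sub>R D"] by (simp add: power_mult_distrib field_simps)
  also have "\<dots> \<le> (norm (x - y))\<^sup>2 + h\<^sup>2 * (L\<^sup>2 * (norm (x - y))\<^sup>2)"
    using n mult_nonneg_nonneg[OF h mono[of x y]] by (simp add: D_def)
  finally show ?thesis by (simp add: algebra_simps)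
qed

section \<open>Almost invariance of the Gibbs measure under the Euler chain\<close>

lemma nn_integral_gauss_shift:
  assumes [measurable]: "f \<in> borel_measurable borel"
  shows "(\<integral>\<^sup>+z. f (a + z) \<partial>gauss s) = (\<integral>\<^sup>+y. ennreal (gauss_density s (y - a)) * f y \<partial>lborel)"
proof -
  have "(\<integral>\<^sup>+z. f (a + z) \<partial>gauss s) = (\<integral>\<^sup>+z. ennreal (gauss_density s ((a + z) - a)) * f (a + z) \<partial>lborel)"
    unfolding gauss_def by (subst nn_integral_density) auto
  also have "\<dots> = (\<integral>\<^sup>+y. ennreal (gauss_density s (y - a)) * f y \<partial>distr lborel borel ((+) a))"
    by (subst nn_integral_distr) auto
  finally show ?thesis by (simp add: lborel_distr_plus)
qed

text \<open>
  Write \<open>A x y\<close> for the joint density of a start from \<open>\<rho>\<close> and the point reached after one step.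
  If \<open>A\<close> were symmetric, then \<open>\<rho>\<close> would be invariant. In general \<open>A y x = A x y \<cdot> exp (R x y)\<close>, and
  \<open>A x y - A y x \<le> A x y \<cdot> |R x y|\<close> bounds the defect by the first absolute moment of \<open>R\<close>. The
  bound depends on \<open>f\<close> only through \<open>B\<close>, and the Markov operator preserves the interval \<open>[0, B]\<close>; this
  is what permits iterating it.
\<close>

lemma nn_integral_kernel_le:
  fixes g :: "real ^ 'n \<Rightarrow> real ^ 'n" and \<rho> f :: "real ^ 'n \<Rightarrow> real" and s :: real
  assumes s: "0 < s" and [measurable]: "g \<in> borel_measurable borel" "\<rho> \<in> borel_measurable borel" "f \<in> borel_measurable borel"
    and R [measurable]: "(\<lambda>(x, y). R x y) \<in> borel_measurable (borel \<Otimes>\<^sub>M borel)"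
    and \<rho>: "\<And>x. 0 \<le> \<rho> x" and f: "\<And>x. 0 \<le> f x" "\<And>x. f x \<le> B"
    and rev: "\<And>x y. \<rho> y * gauss_density s (x - g y) = \<rho> x * gauss_density s (y - g x) * exp (R x y)"
  shows "(\<integral>\<^sup>+x. (\<integral>\<^sup>+z. ennreal (f (g x + z)) \<partial>gauss s) \<partial>density lborel (\<lambda>x. ennreal (\<rho> x)))
    \<le> (\<integral>\<^sup>+x. ennreal (f x) \<partial>density lborel (\<lambda>x. ennreal (\<rho> x)))
      + ennreal B * (\<integral>\<^sup>+x. (\<integral>\<^sup>+z. ennreal \<bar>R x (g x + z)\<bar> \<partial>gauss s) \<partial>density lborel (\<lambda>x. ennreal (\<rho> x)))"
proof -
  define A where "A x y = \<rho> x * gauss_density s (y - g x)" for x y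
  have A0: "0 \<le> A x y" for x y using \<rho> by (simp add: A_def gauss_density_nonneg)
  have [measurable]: "(\<lambda>(x, y). A x y) \<in> borel_measurable (borel \<Otimes>\<^sub>M borel)" unfolding A_def by measurable
  have B0: "0 \<le> B" using f[of 0] by linarith
  interpret prob_space "gauss s :: (real ^ 'n) measure" by (rule prob_space_gauss[OF s])
  have kernel: "(\<integral>\<^sup>+x. (\<integral>\<^sup>+z. F x (g x + z) \<partial>gauss s) \<partial>density lborel (\<lambda>x. ennreal (\<rho> x)))
      = (\<integral>\<^sup>+x. (\<integral>\<^sup>+y. ennreal (A x y) * F x y \<partial>lborel) \<partial>lborel)"
    if [measurable]: "(\<lambda>(x, y). F x y) \<in> borel_measurable (borel \<Otimes>\<^sub>M borel)" for F :: "real ^ 'n \<Rightarrow> real ^ 'n \<Rightarrow> ennreal"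
  proof -
    have "(\<integral>\<^sup>+x. (\<integral>\<^sup>+z. F x (g x + z) \<partial>gauss s) \<partial>density lborel (\<lambda>x. ennreal (\<rho> x)))
        = (\<integral>\<^sup>+x. ennreal (\<rho> x) * (\<integral>\<^sup>+z. F x (g x + z) \<partial>gauss s) \<partial>lborel)"
      by (rule nn_integral_density) auto
    also have "\<dots> = (\<integral>\<^sup>+x. (\<integral>\<^sup>+y. ennreal (A x y) * F x y \<partial>lborel) \<partial>lborel)"
    proof (rule nn_integral_cong)
      fix x
      have "(\<integral>\<^sup>+z. F x (g x + z) \<partial>gauss s) = (\<integral>\<^sup>+y. ennreal (gauss_density s (y - g x)) * F x y \<partial>lborel)"
        by (rule nn_integral_gauss_shift) auto
      then show "ennreal (\<rho> x) * (\<integral>\<^sup>+z. F x (g x + z) \<partial>gauss s) = (\<integral>\<^sup>+y. ennreal (A x y) * F x y \<partial>lborel)"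
        using \<rho> by (simp add: nn_integral_cmult[symmetric] A_def ennreal_mult gauss_density_nonneg mult.assoc)
    qed
    finally show ?thesis .
  qed
  have "(\<integral>\<^sup>+x. (\<integral>\<^sup>+z. ennreal (f (g x + z)) \<partial>gauss s) \<partial>density lborel (\<lambda>x. ennreal (\<rho> x)))
      = (\<integral>\<^sup>+x. (\<integral>\<^sup>+y. ennreal (A x y) * ennreal (f y) \<partial>lborel) \<partial>lborel)"
    by (rule kernel[of "\<lambda>x y. ennreal (f y)"]) measurable
  also have "\<dots> \<le> (\<integral>\<^sup>+x. (\<integral>\<^sup>+y. ennreal (A y x) * ennreal (f y) + ennreal B * (ennreal (A x y) * ennreal \<bar>R x y\<bar>) \<partial>lborel) \<partial>lborel)"
  proof (intro nn_integral_mono)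
    fix x y
    have "1 \<le> exp (R x y) + \<bar>R x y\<bar>" using exp_ge_add_one_self[of "R x y"] by linarith
    then have "A x y * 1 \<le> A x y * (exp (R x y) + \<bar>R x y\<bar>)" by (intro mult_left_mono A0)
    then have 1: "A x y \<le> A y x + A x y * \<bar>R x y\<bar>" using rev[of y x] by (simp add: A_def distrib_left)
    have "A x y * f y \<le> (A y x + A x y * \<bar>R x y\<bar>) * f y" by (rule mult_right_mono[OF 1 f(1)])
    also have "\<dots> \<le> A y x * f y + A x y * \<bar>R x y\<bar> * B"
      using f A0 by (simp add: distrib_right mult_left_mono)
    finally show "ennreal (A x y) * ennreal (f y) \<le> ennreal (A y x) * ennreal (f y) + ennreal B * (ennreal (A x y) * ennreal \<bar>R x y\<bar>)"
      using A0 f B0 by (simp add: ennreal_mult[symmetric] ennreal_plus[symmetric] mult_ac del: ennreal_plus)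
  qed
  also have "\<dots> = (\<integral>\<^sup>+x. (\<integral>\<^sup>+y. ennreal (A y x) * ennreal (f y) \<partial>lborel) \<partial>lborel)
      + ennreal B * (\<integral>\<^sup>+x. (\<integral>\<^sup>+y. ennreal (A x y) * ennreal \<bar>R x y\<bar> \<partial>lborel) \<partial>lborel)"
    by (simp add: nn_integral_add nn_integral_cmult)
  also have "(\<integral>\<^sup>+x. (\<integral>\<^sup>+y. ennreal (A x y) * ennreal \<bar>R x y\<bar> \<partial>lborel) \<partial>lborel)
      = (\<integral>\<^sup>+x. (\<integral>\<^sup>+z. ennreal \<bar>R x (g x + z)\<bar> \<partial>gauss s) \<partial>density lborel (\<lambda>x. ennreal (\<rho> x)))"
    by (rule kernel[symmetric]) measurable
  also have "(\<integral>\<^sup>+x. (\<integral>\<^sup>+y. ennreal (A y x) * ennreal (f y) \<partial>lborel) \<partial>lborel)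
      = (\<integral>\<^sup>+y. (\<integral>\<^sup>+x. ennreal (A y x) * ennreal (f y) \<partial>lborel) \<partial>lborel)"
    by (rule lborel_pair.Fubini') measurable
  also have "\<dots> = (\<integral>\<^sup>+y. (\<integral>\<^sup>+z. ennreal (f y) \<partial>(gauss s :: (real ^ 'n) measure)) \<partial>density lborel (\<lambda>x. ennreal (\<rho> x)))"
    by (rule kernel[of "\<lambda>x y. ennreal (f x)", symmetric]) measurable
  also have "\<dots> = (\<integral>\<^sup>+y. ennreal (f y) \<partial>density lborel (\<lambda>x. ennreal (\<rho> x)))"
    using emeasure_space_1 by simp
  finally show ?thesis .
qed

lemma chain_almost_invariant:
  fixes g :: "real ^ 'n \<Rightarrow> real ^ 'n" and \<rho> f :: "real ^ 'n \<Rightarrow> real" and s e :: real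
  defines "\<mu> \<equiv> density lborel (\<lambda>x. ennreal (\<rho> x))"
  assumes s: "0 < s" and g [measurable]: "g \<in> borel_measurable borel" and \<rho>m [measurable]: "\<rho> \<in> borel_measurable borel"
    and R [measurable]: "(\<lambda>(x, y). R x y) \<in> borel_measurable (borel \<Otimes>\<^sub>M borel)"
    and \<rho>: "\<And>x. 0 \<le> \<rho> x" and prob: "prob_space \<mu>"
    and rev: "\<And>x y. \<rho> y * gauss_density s (x - g y) = \<rho> x * gauss_density s (y - g x) * exp (R x y)"
    and e: "(\<integral>\<^sup>+x. (\<integral>\<^sup>+z. ennreal \<bar>R x (g x + z)\<bar> \<partial>gauss s) \<partial>\<mu>) \<le> ennreal e" "0 \<le> e"
    and f: "f \<in> borel_measurable borel" "\<And>x. 0 \<le> f x" "\<And>x. f x \<le> B"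
  shows "(\<integral>x. (step_op g s ^^ k) f x \<partial>\<mu>) \<le> (\<integral>x. f x \<partial>\<mu>) + real k * (B * e)"
proof (induction k)
  case (Suc k)
  interpret \<mu>: prob_space \<mu> by (rule prob)
  interpret G: prob_space "gauss s :: (real ^ 'n) measure" by (rule prob_space_gauss[OF s])
  have [simp, measurable_cong]: "sets \<mu> = sets borel" by (simp add: \<mu>_def)
  have B0: "0 \<le> B" using f(2,3)[of 0] by linarith
  define F where "F = (step_op g s ^^ k) f"
  have Fm [measurable]: "F \<in> borel_measurable borel" and Fb: "\<And>x. 0 \<le> F x" "\<And>x. F x \<le> B"
    unfolding F_def by (rule step_op_iterate_measurable[OF s g f] step_op_iterate_lower[OF s g f] step_op_iterate_upper[OF s g f])+
  have Qm [measurable]: "step_op g s F \<in> borel_measurable borel" by (rule step_op_measurable[OF s g Fm])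
  have Qb: "0 \<le> step_op g s F x" "step_op g s F x \<le> B" for x using step_op_bounds[OF s Fm Fb] by auto
  have i: "integrable \<mu> h" if "h \<in> borel_measurable borel" "\<And>x. 0 \<le> h x" "\<And>x. h x \<le> B" for h :: "_ \<Rightarrow> real"
    using that by (intro \<mu>.integrable_const_bound[where B = B]) auto
  have "ennreal (\<integral>x. step_op g s F x \<partial>\<mu>) = (\<integral>\<^sup>+x. ennreal (step_op g s F x) \<partial>\<mu>)"
    by (rule nn_integral_eq_integral[symmetric]) (auto intro: i Qb Qm)
  also have "\<dots> = (\<integral>\<^sup>+x. (\<integral>\<^sup>+z. ennreal (F (g x + z)) \<partial>gauss s) \<partial>\<mu>)"
    unfolding step_op_def
    by (intro nn_integral_cong nn_integral_eq_integral[symmetric]) (auto intro: integrable_gauss_bounded[OF s Fm Fb] Fb)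
  also have "\<dots> \<le> (\<integral>\<^sup>+x. ennreal (F x) \<partial>\<mu>) + ennreal B * (\<integral>\<^sup>+x. (\<integral>\<^sup>+z. ennreal \<bar>R x (g x + z)\<bar> \<partial>gauss s) \<partial>\<mu>)"
    unfolding \<mu>_def by (rule nn_integral_kernel_le[OF s g \<rho>m Fm R \<rho> Fb rev])
  also have "(\<integral>\<^sup>+x. ennreal (F x) \<partial>\<mu>) = ennreal (\<integral>x. F x \<partial>\<mu>)"
    by (rule nn_integral_eq_integral) (auto intro: i Fb Fm)
  also have "ennreal (\<integral>x. F x \<partial>\<mu>) + ennreal B * (\<integral>\<^sup>+x. (\<integral>\<^sup>+z. ennreal \<bar>R x (g x + z)\<bar> \<partial>gauss s) \<partial>\<mu>) \<le> ennreal (\<integral>x. F x \<partial>\<mu>) + ennreal B * ennreal e"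
    by (intro add_left_mono mult_left_mono e) auto
  also have "\<dots> = ennreal ((\<integral>x. F x \<partial>\<mu>) + B * e)"
    using B0 e Fb by (simp add: ennreal_mult integral_nonneg_AE)
  finally have "(\<integral>x. step_op g s F x \<partial>\<mu>) \<le> (\<integral>x. F x \<partial>\<mu>) + B * e"
    using B0 e Fb by (subst (asm) ennreal_le_iff) (auto intro!: add_nonneg_nonneg integral_nonneg_AE)
  with Suc show ?case by (simp add: F_def algebra_simps)
qed simp

text \<open>
  The logarithm of the Metropolis--Hastings ratio of the Euler chain for the target \<open>exp (- U)\<close>. Its
  first three terms are minus the error of the trapezoidal rule for \<open>U\<close> between \<open>x\<close> and \<open>y\<close>.
\<close>

definition reversal_exponent :: "(real ^ 'n \<Rightarrow> real) \<Rightarrow> real \<Rightarrow> real ^ 'n \<Rightarrow> real ^ 'n \<Rightarrow> real" where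
  "reversal_exponent U h x y = U x - U y + ((y - x) \<bullet> (gradient U x + gradient U y)) / 2
     + h / 4 * ((norm (gradient U x))\<^sup>2 - (norm (gradient U y))\<^sup>2)"

text \<open>
  With \<open>d = y - x\<close>, the squared norms in the two Gaussian densities are those of \<open>d + h \<nabla>U(x)\<close> and
  \<open>d - h \<nabla>U(y)\<close>. In their difference the terms \<open>|d|\<^sup>2\<close> cancel, and division by \<open>2 s\<^sup>2 = 4 h\<close>
  leaves the trapezoidal sum of the gradients.
\<close>

lemma euler_almost_reversible:
  assumes h: "0 < h"
  shows "exp (- U y) * gauss_density (sqrt (2 * h)) (x - euler_map U h y)
    = exp (- U x) * gauss_density (sqrt (2 * h)) (y - euler_map U h x) * exp (reversal_exponent U h x y)"
proof -
  define d a b where "d = y - x" and "a = gradient U x" and "b = gradient U y"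
  have e: "x - euler_map U h y = h *\<^sub>R b - d" "y - euler_map U h x = d + h *\<^sub>R a"
    by (simp_all add: d_def a_def b_def euler_map_def)
  have n1: "(norm (h *\<^sub>R b - d))\<^sup>2 = h\<^sup>2 * (norm b)\<^sup>2 - 2 * h * (d \<bullet> b) + (norm d)\<^sup>2"
    by (simp add: power2_norm_eq_inner inner_diff_left inner_diff_right inner_commute power2_eq_square[of h] algebra_simps)
  have n2: "(norm (d + h *\<^sub>R a))\<^sup>2 = h\<^sup>2 * (norm a)\<^sup>2 + 2 * h * (d \<bullet> a) + (norm d)\<^sup>2"
    by (simp add: power2_norm_eq_inner inner_add_left inner_add_right inner_commute power2_eq_square[of h] algebra_simps)
  have "- U y + - (norm (h *\<^sub>R b - d))\<^sup>2 / (2 * (sqrt (2 * h))\<^sup>2)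
      = - U x + - (norm (d + h *\<^sub>R a))\<^sup>2 / (2 * (sqrt (2 * h))\<^sup>2) + reversal_exponent U h x y"
    unfolding n1 n2 reversal_exponent_def d_def[symmetric] a_def[symmetric] b_def[symmetric]
    using h by (simp add: inner_add_right field_simps power2_eq_square[of h])
  then have "exp (- U y) * exp (- (norm (h *\<^sub>R b - d))\<^sup>2 / (2 * (sqrt (2 * h))\<^sup>2))
      = exp (- U x) * exp (- (norm (d + h *\<^sub>R a))\<^sup>2 / (2 * (sqrt (2 * h))\<^sup>2)) * exp (reversal_exponent U h x y)"
    by (simp only: exp_add[symmetric])
  then show ?thesis unfolding e gauss_density_eq by (simp add: mult_ac)
qed

lemma reversal_exponent_bound:
  fixes U :: "real ^ 'n \<Rightarrow> real"
  assumes U: "\<And>x. U differentiable (at x)" and L: "L-lipschitz_on UNIV (gradient U)" and h: "0 \<le> h"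
  shows "\<bar>reversal_exponent U h x (x + d)\<bar>
    \<le> 2 * L * (norm d)\<^sup>2 + h * (L\<^sup>2 * (norm d)\<^sup>2 + (norm (gradient U x))\<^sup>2)"
proof -
  define a b where "a = gradient U x" and "b = gradient U (x + d)"
  have "norm (b - a) \<le> L * norm d"
    using lipschitz_onD[OF L, of "x + d" x] by (simp add: dist_norm a_def b_def)
  then have ba: "(norm (b - a))\<^sup>2 \<le> L\<^sup>2 * (norm d)\<^sup>2"
    using power_mono[of "norm (b - a)" "L * norm d" 2] by (simp add: power_mult_distrib)
  have "norm b \<le> norm (b - a) + norm a" using norm_triangle_ineq[of "b - a" a] by simp
  then have "(norm b)\<^sup>2 \<le> (norm (b - a) + norm a)\<^sup>2" by (intro power_mono) auto
  also have "\<dots> \<le> 2 * (norm (b - a))\<^sup>2 + 2 * (norm a)\<^sup>2"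
    using zero_le_power2[of "norm (b - a) - norm a"] by (simp add: power2_sum power2_diff)
  finally have "\<bar>(norm a)\<^sup>2 - (norm b)\<^sup>2\<bar> \<le> 2 * (L\<^sup>2 * (norm d)\<^sup>2) + 2 * (norm a)\<^sup>2"
    using ba zero_le_power2[of "norm b"] zero_le_power2[of "norm a"] zero_le_power2[of "norm (b - a)"] by linarith
  then have "\<bar>h / 4 * ((norm a)\<^sup>2 - (norm b)\<^sup>2)\<bar> \<le> h / 4 * (2 * (L\<^sup>2 * (norm d)\<^sup>2) + 2 * (norm a)\<^sup>2)"
    using h by (simp add: abs_mult mult_left_mono)
  also have "\<dots> \<le> h * (L\<^sup>2 * (norm d)\<^sup>2 + (norm a)\<^sup>2)"
    using h by (simp add: field_simps)
  finally have 1: "\<bar>h / 4 * ((norm a)\<^sup>2 - (norm b)\<^sup>2)\<bar> \<le> h * (L\<^sup>2 * (norm d)\<^sup>2 + (norm a)\<^sup>2)" .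
  have "reversal_exponent U h x (x + d)
      = - (U (x + d) - U x - (d \<bullet> (gradient U x + gradient U (x + d))) / 2) + h / 4 * ((norm a)\<^sup>2 - (norm b)\<^sup>2)"
    by (simp add: reversal_exponent_def a_def b_def)
  then show ?thesis
    using 1 trapezoid_error_lipschitz[OF U L, of x d] unfolding a_def by linarith
qed

lemma reversal_exponent_little_o:
  fixes U :: "real ^ 'n \<Rightarrow> real"
  assumes U: "\<And>x. U differentiable (at x)" and U2: "gradient U differentiable (at x)"
    and h: "\<And>n. 0 < h n" "h \<longlonglongrightarrow> 0"
    and d: "d \<longlonglongrightarrow> 0" "\<And>n. (norm (d n))\<^sup>2 \<le> h n * D"
  shows "(\<lambda>n. reversal_exponent U (h n) x (x + d n) / h n) \<longlonglongrightarrow> 0"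
proof -
  define T where "T d = U (x + d) - U x - (d \<bullet> (gradient U x + gradient U (x + d))) / 2" for d
  have T: "(\<lambda>n. T (d n) / h n) \<longlonglongrightarrow> 0"
  proof (rule LIMSEQ_I)
    fix r :: real assume r: "0 < r"
    define \<epsilon> where "\<epsilon> = r / (4 * (\<bar>D\<bar> + 1))"
    have \<epsilon>: "0 < \<epsilon>" using r by (simp add: \<epsilon>_def add_nonneg_pos)
    obtain \<delta> where \<delta>: "0 < \<delta>" "\<And>d. norm d < \<delta> \<Longrightarrow> \<bar>T d\<bar> \<le> 2 * \<epsilon> * (norm d)\<^sup>2"
      using trapezoid_error_little_o[OF U U2 \<epsilon>] unfolding T_def by blast
    obtain n0 where n0: "\<And>n. n \<ge> n0 \<Longrightarrow> norm (d n - 0) < \<delta>" using LIMSEQ_D[OF d(1) \<delta>(1)] by blast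
    show "\<exists>n0. \<forall>n\<ge>n0. norm (T (d n) / h n - 0) < r"
    proof (intro exI[of _ n0] allI impI)
      fix n assume "n0 \<le> n"
      then have "\<bar>T (d n)\<bar> \<le> 2 * \<epsilon> * (norm (d n))\<^sup>2" using n0[of n] \<delta> by simp
      also have "\<dots> \<le> 2 * \<epsilon> * (h n * D)" using d(2)[of n] \<epsilon> by (intro mult_left_mono) auto
      also have "\<dots> \<le> 2 * \<epsilon> * (h n * (\<bar>D\<bar> + 1))" using h(1)[of n] \<epsilon> by (intro mult_left_mono) auto
      also have "\<dots> = h n * (r / 2)" by (simp add: \<epsilon>_def field_simps add_nonneg_eq_0_iff)
      also have "\<dots> < h n * r" using h(1)[of n] r by (intro mult_strict_left_mono) auto
      finally show "norm (T (d n) / h n - 0) < r" using h(1)[of n] by (simp add: pos_divide_less_eq mult.commute)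
    qed
  qed
  have "isCont (gradient U) x" using U2 by (rule differentiable_imp_continuous_within)
  then have "(\<lambda>n. gradient U (x + d n)) \<longlonglongrightarrow> gradient U x"
    using tendsto_add[OF tendsto_const[of x] d(1)] by (intro isCont_tendsto_compose[of _ "gradient U"]) auto
  then have "(\<lambda>n. - (T (d n) / h n) + ((norm (gradient U x))\<^sup>2 - (norm (gradient U (x + d n)))\<^sup>2) / 4)
      \<longlonglongrightarrow> - 0 + ((norm (gradient U x))\<^sup>2 - (norm (gradient U x))\<^sup>2) / 4"
    by (intro tendsto_intros T) auto
  moreover have "- (T (d n) / h n) + ((norm (gradient U x))\<^sup>2 - (norm (gradient U (x + d n)))\<^sup>2) / 4
      = reversal_exponent U (h n) x (x + d n) / h n" for n
    using h(1)[of n] by (simp add: reversal_exponent_def T_def field_simps)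
  ultimately show ?thesis by simp
qed

text \<open>
  A step of length \<open>h\<close> moves the point by a vector \<open>d\<close> with \<open>|d|\<^sup>2\<close> of order \<open>h\<close>. Hence the exponent
  is pointwise of smaller order than \<open>h\<close>, by the second-order differentiability of \<open>U\<close>, and it is
  bounded by \<open>h\<close> times an integrable function, by the Lipschitz condition and the second moment
  of \<open>\<mu>\<close>. Dominated convergence turns this into a mean of smaller order than \<open>h\<close>, so that the sum
  of the defects over \<open>t / h\<close> steps tends to \<open>0\<close>.
\<close>

lemma reversal_exponent_mean_little_o:
  fixes U :: "real ^ 'n \<Rightarrow> real" and \<mu> :: "(real ^ 'n) measure"
  assumes U: "\<And>x. U differentiable (at x)" and U2: "\<And>x. gradient U differentiable (at x)"
    and L: "L-lipschitz_on UNIV (gradient U)"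
    and \<mu>: "prob_space \<mu>" "sets \<mu> = sets borel" and mom: "integrable \<mu> (\<lambda>x. (norm x)\<^sup>2)"
    and h: "\<And>n. 0 < h n" "\<And>n. h n \<le> t" "h \<longlonglongrightarrow> 0"
  shows "\<exists>e. (\<forall>n. 0 \<le> e n) \<and> e \<longlonglongrightarrow> 0 \<and> (\<forall>n.
    (\<integral>\<^sup>+x. (\<integral>\<^sup>+z. ennreal \<bar>reversal_exponent U (h n) x (euler_map U (h n) x + z)\<bar> \<partial>gauss (sqrt (2 * h n))) \<partial>\<mu>)
      \<le> ennreal (h n * e n))"
proof -
  interpret \<mu>: prob_space \<mu> by (rule \<mu>)
  interpret G: prob_space "gauss 1 :: (real ^ 'n) measure" by (rule prob_space_gauss) simp
  interpret P: pair_prob_space \<mu> "gauss 1 :: (real ^ 'n) measure" ..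
  note [measurable_cong] = \<mu>(2)
  have [measurable]: "U \<in> borel_measurable borel"
    using U differentiable_imp_continuous_within by (intro borel_measurable_continuous_onI continuous_at_imp_continuous_on) blast
  have [measurable]: "gradient U \<in> borel_measurable borel"
    by (rule borel_measurable_continuous_onI[OF lipschitz_on_continuous_on[OF L]])
  have L0: "0 \<le> L" by (rule lipschitz_on_nonneg[OF L])
  have t: "0 < t" using h(1,2)[of 0] by linarith
  \<comment> \<open>The noise is written as \<open>sqrt (2 h)\<close> times a standard Gaussian \<open>z\<close>, so that all step sizes live on
      one probability space and dominated convergence applies.\<close>
  define d where "d n x z = sqrt (2 * h n) *\<^sub>R z - h n *\<^sub>R gradient U x" for n x and z :: "real ^ 'n"
  define D where "D x z = 4 * (norm z)\<^sup>2 + 2 * t * (norm (gradient U x))\<^sup>2" for x and z :: "real ^ 'n"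
  have D0: "0 \<le> D x z" for x z using t by (simp add: D_def)
  have dD: "(norm (d n x z))\<^sup>2 \<le> h n * D x z" for n x z
  proof -
    have "norm (d n x z) \<le> sqrt (2 * h n) * norm z + h n * norm (gradient U x)"
      unfolding d_def using h(1)[of n] by (intro order_trans[OF norm_triangle_ineq4]) auto
    then have "(norm (d n x z))\<^sup>2 \<le> (sqrt (2 * h n) * norm z + h n * norm (gradient U x))\<^sup>2"
      by (intro power_mono) auto
    also have "\<dots> \<le> 2 * (sqrt (2 * h n) * norm z)\<^sup>2 + 2 * (h n * norm (gradient U x))\<^sup>2"
      using zero_le_power2[of "sqrt (2 * h n) * norm z - h n * norm (gradient U x)"] by (simp add: power2_sum power2_diff)
    also have "\<dots> = h n * (4 * (norm z)\<^sup>2 + 2 * (h n * (norm (gradient U x))\<^sup>2))"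
      using h(1)[of n] by (simp add: power_mult_distrib power2_eq_square[of "h n"] algebra_simps)
    also have "\<dots> \<le> h n * D x z"
      unfolding D_def using h(1,2)[of n] mult_right_mono[OF h(2), of "(norm (gradient U x))\<^sup>2" n] by (intro mult_left_mono) auto
    finally show ?thesis .
  qed
  have d0: "(\<lambda>n. d n x z) \<longlonglongrightarrow> 0" for x z
  proof -
    have "(\<lambda>n. sqrt (2 * h n) *\<^sub>R z - h n *\<^sub>R gradient U x) \<longlonglongrightarrow> sqrt (2 * 0) *\<^sub>R z - 0 *\<^sub>R gradient U x"
      by (intro tendsto_intros h)
    then show ?thesis by (simp add: d_def)
  qed
  define r where "r n p = \<bar>reversal_exponent U (h n) (fst p) (fst p + d n (fst p) (snd p))\<bar> / h n" for n p
  have rm [measurable]: "r n \<in> borel_measurable (\<mu> \<Otimes>\<^sub>M gauss 1)" for n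
    unfolding r_def d_def reversal_exponent_def by measurable
  have r0: "0 \<le> r n p" for n p using h(1)[of n] by (simp add: r_def)
  define w where "w p = 2 * L * D (fst p) (snd p) + (L\<^sup>2 * (t * D (fst p) (snd p)) + (norm (gradient U (fst p)))\<^sup>2)" for p
  have rw: "r n p \<le> w p" for n p
  proof -
    obtain x z where p: "p = (x, z)" by (cases p)
    have "\<bar>reversal_exponent U (h n) x (x + d n x z)\<bar>
        \<le> 2 * L * (norm (d n x z))\<^sup>2 + h n * (L\<^sup>2 * (norm (d n x z))\<^sup>2 + (norm (gradient U x))\<^sup>2)"
      using h(1)[of n] by (intro reversal_exponent_bound[OF U L]) auto
    also have "\<dots> \<le> 2 * L * (h n * D x z) + h n * (L\<^sup>2 * (t * D x z) + (norm (gradient U x))\<^sup>2)"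
    proof -
      have "(norm (d n x z))\<^sup>2 \<le> t * D x z"
        using dD[of n x z] mult_right_mono[OF h(2)[of n] D0[of x z]] by linarith
      then show ?thesis
        using h(1)[of n] L0 dD[of n x z] by (intro add_mono mult_left_mono) auto
    qed
    also have "\<dots> = h n * w p" by (simp add: w_def p algebra_simps)
    finally show ?thesis using h(1)[of n] by (simp add: r_def p pos_divide_le_eq mult.commute)
  qed
  have ig: "integrable \<mu> (\<lambda>x. (norm (gradient U x))\<^sup>2)"
  proof (rule Bochner_Integration.integrable_bound)
    show "integrable \<mu> (\<lambda>x. 2 * L\<^sup>2 * (norm x)\<^sup>2 + 2 * (norm (gradient U 0))\<^sup>2)"
      using mom by (intro Bochner_Integration.integrable_add \<mu>.integrable_const integrable_mult_right)
    have "(norm (gradient U x))\<^sup>2 \<le> 2 * L\<^sup>2 * (norm x)\<^sup>2 + 2 * (norm (gradient U 0))\<^sup>2" for x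
    proof -
      have "norm (gradient U x - gradient U 0) \<le> L * norm x"
        using lipschitz_onD[OF L, of x 0] by (simp add: dist_norm)
      then have "norm (gradient U x) \<le> L * norm x + norm (gradient U 0)"
        using norm_triangle_ineq[of "gradient U x - gradient U 0" "gradient U 0"] by simp
      then have "(norm (gradient U x))\<^sup>2 \<le> (L * norm x + norm (gradient U 0))\<^sup>2" by (intro power_mono) auto
      also have "\<dots> \<le> 2 * (L * norm x)\<^sup>2 + 2 * (norm (gradient U 0))\<^sup>2"
        using zero_le_power2[of "L * norm x - norm (gradient U 0)"] by (simp add: power2_sum power2_diff)
      finally show ?thesis by (simp add: power_mult_distrib)
    qed
    then show "AE x in \<mu>. norm ((norm (gradient U x))\<^sup>2) \<le> norm (2 * L\<^sup>2 * (norm x)\<^sup>2 + 2 * (norm (gradient U 0))\<^sup>2)"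
      by simp
  qed measurable
  have if1: "integrable (\<mu> \<Otimes>\<^sub>M gauss 1) (\<lambda>p :: (real ^ 'n) \<times> (real ^ 'n). (norm (gradient U (fst p)))\<^sup>2)"
    by (rule P.Fubini_integrable) (use ig G.prob_space in simp_all)
  have if2: "integrable (\<mu> \<Otimes>\<^sub>M gauss 1) (\<lambda>p :: (real ^ 'n) \<times> (real ^ 'n). (norm (snd p))\<^sup>2)"
    by (rule P.Fubini_integrable) (use integrable_gauss_norm_sq[of 1, where 'n = 'n] in simp_all)
  have iw: "integrable (\<mu> \<Otimes>\<^sub>M gauss 1) w"
    unfolding w_def D_def using if1 if2 by simp
  have ir: "integrable (\<mu> \<Otimes>\<^sub>M gauss 1) (r n)" for n
    by (rule Bochner_Integration.integrable_bound[OF iw]) (use r0 order_trans[OF rw abs_ge_self] in \<open>simp_all\<close>)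
  define e where "e n = (\<integral>p. r n p \<partial>(\<mu> \<Otimes>\<^sub>M gauss 1))" for n
  have "(\<lambda>n. \<integral>p. r n p \<partial>(\<mu> \<Otimes>\<^sub>M gauss 1)) \<longlonglongrightarrow> (\<integral>p. 0 \<partial>(\<mu> \<Otimes>\<^sub>M (gauss 1 :: (real ^ 'n) measure)))"
  proof (rule integral_dominated_convergence[OF _ _ iw])
    show "AE p in \<mu> \<Otimes>\<^sub>M gauss 1. (\<lambda>n. r n p) \<longlonglongrightarrow> 0"
    proof (intro always_eventually allI)
      fix p
      have "(\<lambda>n. \<bar>reversal_exponent U (h n) (fst p) (fst p + d n (fst p) (snd p)) / h n\<bar>) \<longlonglongrightarrow> 0"
        by (rule tendsto_rabs_zero[OF reversal_exponent_little_o[OF U U2 h(1,3) d0 dD]])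
      then show "(\<lambda>n. r n p) \<longlonglongrightarrow> 0" using h(1) by (simp add: r_def abs_divide less_imp_le abs_of_pos)
    qed
    show "AE p in \<mu> \<Otimes>\<^sub>M gauss 1. norm (r n p) \<le> w p" for n using rw r0 by simp
  qed auto
  then have e0: "e \<longlonglongrightarrow> 0" by (simp add: e_def[abs_def])
  have "(\<integral>\<^sup>+x. (\<integral>\<^sup>+z. ennreal \<bar>reversal_exponent U (h n) x (euler_map U (h n) x + z)\<bar> \<partial>gauss (sqrt (2 * h n))) \<partial>\<mu>)
      = ennreal (h n * e n)" for n
  proof -
    have hn: "0 < sqrt (2 * h n)" using h(1)[of n] by simp
    have "(\<integral>\<^sup>+z. ennreal \<bar>reversal_exponent U (h n) x (euler_map U (h n) x + z)\<bar> \<partial>gauss (sqrt (2 * h n)))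
        = (\<integral>\<^sup>+z. ennreal (h n * r n (x, z)) \<partial>gauss 1)" for x
    proof -
      have "euler_map U (h n) x + sqrt (2 * h n) *\<^sub>R z = x + d n x z" for z
        by (simp add: euler_map_def d_def algebra_simps)
      moreover have "(\<lambda>z. ennreal \<bar>reversal_exponent U (h n) x (euler_map U (h n) x + z)\<bar>) \<in> borel_measurable borel"
        unfolding reversal_exponent_def by measurable
      ultimately show ?thesis
        using h(1)[of n] by (subst gauss_scale[OF hn], subst nn_integral_distr) (simp_all add: r_def)
    qed
    then have "(\<integral>\<^sup>+x. (\<integral>\<^sup>+z. ennreal \<bar>reversal_exponent U (h n) x (euler_map U (h n) x + z)\<bar> \<partial>gauss (sqrt (2 * h n))) \<partial>\<mu>)
        = (\<integral>\<^sup>+x. (\<integral>\<^sup>+z. ennreal (h n * r n (x, z)) \<partial>gauss 1) \<partial>\<mu>)" by simp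
    also have "\<dots> = (\<integral>\<^sup>+p. ennreal (h n * r n p) \<partial>(\<mu> \<Otimes>\<^sub>M gauss 1))"
      by (rule G.nn_integral_fst) measurable
    also have "\<dots> = ennreal (\<integral>p. h n * r n p \<partial>(\<mu> \<Otimes>\<^sub>M gauss 1))"
      using h(1)[of n] r0 by (intro nn_integral_eq_integral) (auto intro!: ir integrable_mult_right simp: less_imp_le)
    finally show ?thesis by (simp add: e_def)
  qed
  moreover have "0 \<le> e n" for n unfolding e_def using r0 by (intro integral_nonneg_AE) simp
  ultimately show ?thesis using e0 by (intro exI[of _ e]) auto
qed

section \<open>Convergence of the Euler scheme\<close>

fun euler_path :: "(real ^ 'n \<Rightarrow> real ^ 'n) \<Rightarrow> real ^ 'n \<Rightarrow> (nat \<Rightarrow> real ^ 'n) \<Rightarrow> nat \<Rightarrow> real ^ 'n" where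
  "euler_path g x w 0 = x"
| "euler_path g x w (Suc j) = g (euler_path g x w j) + w j"

lemma euler_path_cong: "(\<And>i. i < j \<Longrightarrow> w i = w' i) \<Longrightarrow> euler_path g x w j = euler_path g x w' j"
  by (induction j) auto

lemma euler_path_measurable:
  fixes g :: "real ^ 'n \<Rightarrow> real ^ 'n"
  assumes [measurable]: "g \<in> borel_measurable borel"
  shows "j \<le> k \<Longrightarrow> (\<lambda>w. euler_path g x w j) \<in> PiM {..<k} (\<lambda>_. borel) \<rightarrow>\<^sub>M borel"
proof (induction j)
  case (Suc j)
  then have [measurable]: "(\<lambda>w. euler_path g x w j) \<in> PiM {..<k} (\<lambda>_. borel) \<rightarrow>\<^sub>M borel" by simp
  have [measurable]: "(\<lambda>w. w j) \<in> PiM {..<k} (\<lambda>_. borel :: (real ^ 'n) measure) \<rightarrow>\<^sub>M borel"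
    using Suc.prems by (intro measurable_component_singleton) auto
  show ?case by simp
qed simp

text \<open>
  The last increment is independent of the earlier ones and hence of the point reached before it,
  so integrating it out replaces \<open>\<phi>\<close> by \<open>step_op g s \<phi>\<close>.
\<close>

lemma (in prob_space) euler_path_expectation:
  fixes g :: "real ^ 'n \<Rightarrow> real ^ 'n" and \<xi> :: "nat \<Rightarrow> 'a \<Rightarrow> real ^ 'n"
  assumes s: "0 < s" and g [measurable]: "g \<in> borel_measurable borel"
    and ind: "indep_vars (\<lambda>_. borel) \<xi> {..<k}" and law: "\<And>j. j < k \<Longrightarrow> distr M borel (\<xi> j) = gauss s"
    and \<phi> [measurable]: "\<phi> \<in> borel_measurable borel" and bd: "\<And>x. l \<le> \<phi> x" "\<And>x. \<phi> x \<le> u"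
  shows "expectation (\<lambda>\<omega>. \<phi> (euler_path g x (\<lambda>j. \<xi> j \<omega>) k)) = (step_op g s ^^ k) \<phi> x"
  using ind law \<phi> bd
proof (induction k arbitrary: \<phi>)
  case 0
  then show ?case by (simp add: prob_space)
next
  case (Suc k)
  note [measurable] = Suc.prems(3)
  interpret G: prob_space "gauss s :: (real ^ 'n) measure" by (rule prob_space_gauss[OF s])
  define Y where "Y \<omega> = euler_path g x (\<lambda>j. \<xi> j \<omega>) k" for \<omega>
  have rv: "random_variable borel (\<xi> j)" if "j < Suc k" for j
    using Suc.prems(1) that by (auto simp: indep_vars_def)
  have "indep_var (PiM {..<k} (\<lambda>_. borel)) (\<lambda>\<omega>. restrict (\<lambda>i. \<xi> i \<omega>) {..<k}) (PiM {k} (\<lambda>_. borel)) (\<lambda>\<omega>. restrict (\<lambda>i. \<xi> i \<omega>) {k})"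
    by (rule indep_var_restrict[OF Suc.prems(1)]) auto
  then have "indep_var borel ((\<lambda>w. euler_path g x w k) \<circ> (\<lambda>\<omega>. restrict (\<lambda>i. \<xi> i \<omega>) {..<k}))
      borel ((\<lambda>w. w k) \<circ> (\<lambda>\<omega>. restrict (\<lambda>i. \<xi> i \<omega>) {k}))"
    by (rule indep_var_compose) (auto intro: euler_path_measurable[OF g] measurable_component_singleton)
  moreover have "(\<lambda>w. euler_path g x w k) \<circ> (\<lambda>\<omega>. restrict (\<lambda>i. \<xi> i \<omega>) {..<k}) = Y"
    by (auto simp: Y_def fun_eq_iff intro!: euler_path_cong)
  moreover have "(\<lambda>w. w k) \<circ> (\<lambda>\<omega>. restrict (\<lambda>i. \<xi> i \<omega>) {k}) = \<xi> k" by auto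
  ultimately have iv: "indep_var borel Y borel (\<xi> k)" by simp
  then have Ym [measurable]: "random_variable borel Y" by (rule indep_var_rv1)
  have \<xi>m [measurable]: "random_variable borel (\<xi> k)" by (rule rv) simp
  interpret Y: prob_space "distr M borel Y" by (rule prob_space_distr) simp
  interpret YG: pair_prob_space "distr M borel Y" "gauss s :: (real ^ 'n) measure" ..
  have "distr M borel Y \<Otimes>\<^sub>M distr M borel (\<xi> k) = distr M (borel \<Otimes>\<^sub>M borel) (\<lambda>\<omega>. (Y \<omega>, \<xi> k \<omega>))"
    using iv by (simp add: indep_var_distribution_eq)
  then have J: "distr M borel Y \<Otimes>\<^sub>M gauss s = distr M (borel \<Otimes>\<^sub>M borel) (\<lambda>\<omega>. (Y \<omega>, \<xi> k \<omega>))"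
    using Suc.prems(2)[of k] by simp
  have "expectation (\<lambda>\<omega>. \<phi> (euler_path g x (\<lambda>j. \<xi> j \<omega>) (Suc k))) = expectation (\<lambda>\<omega>. \<phi> (g (Y \<omega>) + \<xi> k \<omega>))"
    by (simp add: Y_def)
  also have "\<dots> = (\<integral>p. \<phi> (g (fst p) + snd p) \<partial>(distr M borel Y \<Otimes>\<^sub>M gauss s))"
    unfolding J by (subst integral_distr) auto
  also have "\<dots> = (\<integral>y. (\<integral>z. \<phi> (g y + z) \<partial>gauss s) \<partial>distr M borel Y)"
  proof -
    have "\<bar>\<phi> y\<bar> \<le> \<bar>l\<bar> + \<bar>u\<bar>" for y using Suc.prems(4,5)[of y] by linarith
    then have "integrable (distr M borel Y \<Otimes>\<^sub>M gauss s) (\<lambda>p. \<phi> (g (fst p) + snd p))"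
      by (intro YG.integrable_const_bound[where B = "\<bar>l\<bar> + \<bar>u\<bar>"]) auto
    from YG.integral_fst'[OF this] show ?thesis by simp
  qed
  also have "\<dots> = expectation (\<lambda>\<omega>. step_op g s \<phi> (Y \<omega>))"
    unfolding step_op_def[symmetric] by (subst integral_distr) (auto simp: s)
  also have "\<dots> = (step_op g s ^^ k) (step_op g s \<phi>) x"
    unfolding Y_def
  proof (rule Suc.IH)
    show "indep_vars (\<lambda>_. borel) \<xi> {..<k}" by (rule indep_vars_subset[OF Suc.prems(1)]) auto
  qed (use Suc.prems s g step_op_bounds[OF s Suc.prems(3-5)] in auto)
  finally show ?case by (simp add: funpow_swap1)
qed

text \<open>
  A discrete Gronwall estimate. The noise is additive and the scheme uses the increments of the
  same noise, so it cancels in the difference of the two paths. At every time of a step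
  the drift of the solution differs from that of the scheme by at most \<open>L\<close> times the sum of the current error
  and the oscillation \<open>\<omega>\<close> of the solution on a time interval of length \<open>h\<close>.
\<close>

lemma euler_path_error:
  fixes b :: "real ^ 'n \<Rightarrow> real ^ 'n" and X n :: "real \<Rightarrow> real ^ 'n"
  assumes L: "L-lipschitz_on UNIV b" and cX: "continuous_on {0..} X" and X0: "X 0 = x"
    and eq: "\<And>r. 0 \<le> r \<Longrightarrow> X r = x - integral {0..r} (\<lambda>s. b (X s)) + n r"
    and h: "0 < h" and T: "T = real k * h"
    and mod: "\<And>r r'. r \<in> {0..T} \<Longrightarrow> r' \<in> {0..T} \<Longrightarrow> \<bar>r - r'\<bar> \<le> h \<Longrightarrow> norm (X r - X r') \<le> \<omega>"
    and w: "\<And>j. w j = n (real (Suc j) * h) - n (real j * h)"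
  shows "j \<le> k \<Longrightarrow> norm (X (real j * h) - euler_path (\<lambda>y. y - h *\<^sub>R b y) x w j) \<le> \<omega> * ((1 + h * L) ^ j - 1)"
proof (induction j)
  case 0
  then show ?case using X0 by simp
next
  case (Suc j)
  have L0: "0 \<le> L" by (rule lipschitz_on_nonneg[OF L])
  have cb: "continuous_on A (\<lambda>s. b (X s))" if "A \<subseteq> {0..}" for A
    by (rule continuous_on_compose2[OF lipschitz_on_continuous_on[OF L] continuous_on_subset[OF cX that]]) simp
  define p where "p = real j * h"
  define p' where "p' = real (Suc j) * h"
  define Y where "Y = euler_path (\<lambda>y. y - h *\<^sub>R b y) x w j"
  define e where "e = norm (X p - Y)"
  have pp: "0 \<le> p" "p \<le> p'" "p' - p = h" using h by (auto simp: p_def p'_def algebra_simps)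
  have p'T: "p' \<le> T" using Suc.prems h by (auto simp: p'_def T simp del: of_nat_Suc intro!: mult_right_mono)
  have IH: "e \<le> \<omega> * ((1 + h * L) ^ j - 1)" using Suc by (simp add: e_def Y_def p_def)
  have "integral {0..p'} (\<lambda>s. b (X s)) = integral {0..p} (\<lambda>s. b (X s)) + integral {p..p'} (\<lambda>s. b (X s))"
    by (rule Henstock_Kurzweil_Integration.integral_combine[symmetric])
       (use pp in \<open>auto intro!: integrable_continuous_real cb\<close>)
  then have step: "X p' = X p - integral {p..p'} (\<lambda>s. b (X s)) + w j"
    using eq[of p] eq[of p'] pp by (simp add: w p_def p'_def)
  have I: "integral {p..p'} (\<lambda>s. b (X s)) - h *\<^sub>R b Y = integral {p..p'} (\<lambda>s. b (X s) - b Y)"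
    using pp by (subst Henstock_Kurzweil_Integration.integral_diff) (auto intro!: integrable_continuous_real cb)
  have "norm (integral {p..p'} (\<lambda>s. b (X s) - b Y)) \<le> L * (\<omega> + e) * (p' - p)"
  proof (rule integral_bound)
    show "continuous_on {p..p'} (\<lambda>s. b (X s) - b Y)" using pp by (intro continuous_intros cb) auto
    fix r assume r: "r \<in> {p..p'}"
    have "norm (b (X r) - b Y) \<le> L * norm (X r - Y)"
      using lipschitz_onD[OF L, of "X r" Y] by (simp add: dist_norm)
    also have "norm (X r - Y) \<le> norm (X r - X p) + e"
      unfolding e_def by (metis diff_add_cancel add_diff_eq norm_triangle_ineq)
    also have "norm (X r - X p) \<le> \<omega>" using r pp p'T by (intro mod) auto
    finally show "norm (b (X r) - b Y) \<le> L * (\<omega> + e)" using L0 by (simp add: mult_left_mono)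
  qed (use pp in simp)
  then have B: "norm (integral {p..p'} (\<lambda>s. b (X s) - b Y)) \<le> h * L * (\<omega> + e)" using pp by (simp add: mult_ac)
  have "X p' - euler_path (\<lambda>y. y - h *\<^sub>R b y) x w (Suc j) = (X p - Y) - integral {p..p'} (\<lambda>s. b (X s) - b Y)"
    unfolding step I[symmetric] by (simp add: Y_def)
  then have "norm (X p' - euler_path (\<lambda>y. y - h *\<^sub>R b y) x w (Suc j)) \<le> e + h * L * (\<omega> + e)"
    unfolding e_def using norm_triangle_ineq4[of "X p - Y" "integral {p..p'} (\<lambda>s. b (X s) - b Y)"] B
    by (simp add: e_def)
  also have "\<dots> = (1 + h * L) * e + h * L * \<omega>" by (simp add: algebra_simps)
  also have "\<dots> \<le> (1 + h * L) * (\<omega> * ((1 + h * L) ^ j - 1)) + h * L * \<omega>"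
    using IH h L0 by (intro add_right_mono mult_left_mono) auto
  also have "\<dots> = \<omega> * ((1 + h * L) ^ Suc j - 1)" by (simp add: algebra_simps)
  finally show ?case by (simp add: p'_def)
qed

lemma euler_path_converges:
  fixes b :: "real ^ 'n \<Rightarrow> real ^ 'n" and X n :: "real \<Rightarrow> real ^ 'n"
  assumes L: "L-lipschitz_on UNIV b" and cX: "continuous_on {0..} X" and X0: "X 0 = x"
    and eq: "\<And>r. 0 \<le> r \<Longrightarrow> X r = x - integral {0..r} (\<lambda>s. b (X s)) + n r"
    and t: "0 < t"
  shows "(\<lambda>m. let h = t / real (Suc m) in
      euler_path (\<lambda>y. y - h *\<^sub>R b y) x (\<lambda>j. n (real (Suc j) * h) - n (real j * h)) (Suc m)) \<longlonglongrightarrow> X t"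
proof (rule LIMSEQ_I)
  fix r :: real assume r: "0 < r"
  have L0: "0 \<le> L" by (rule lipschitz_on_nonneg[OF L])
  define \<omega> where "\<omega> = r / (2 * exp (t * L))"
  have \<omega>: "0 < \<omega>" using r by (simp add: \<omega>_def)
  have "uniformly_continuous_on {0..t} X"
    by (rule compact_uniformly_continuous[OF continuous_on_subset[OF cX]]) auto
  then obtain \<delta> where \<delta>: "0 < \<delta>" "\<And>r r'. r \<in> {0..t} \<Longrightarrow> r' \<in> {0..t} \<Longrightarrow> dist r' r < \<delta> \<Longrightarrow> dist (X r') (X r) < \<omega>"
    using \<omega> unfolding uniformly_continuous_on_def by metis
  obtain m0 where m0: "t / \<delta> < real m0" using reals_Archimedean2 by blast
  show "\<exists>m0. \<forall>m\<ge>m0. norm ((let h = t / real (Suc m) in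
      euler_path (\<lambda>y. y - h *\<^sub>R b y) x (\<lambda>j. n (real (Suc j) * h) - n (real j * h)) (Suc m)) - X t) < r"
  proof (intro exI[of _ m0] allI impI)
    fix m assume "m0 \<le> m"
    define h where "h = t / real (Suc m)"
    define w where "w = (\<lambda>j. n (real (Suc j) * h) - n (real j * h))"
    have h: "0 < h" "real (Suc m) * h = t" using t by (auto simp: h_def)
    have "t / \<delta> < real (Suc m)" using m0 \<open>m0 \<le> m\<close> by linarith
    then have h\<delta>: "h < \<delta>" using \<delta>(1) by (simp add: h_def field_simps)
    have "norm (X (real (Suc m) * h) - euler_path (\<lambda>y. y - h *\<^sub>R b y) x w (Suc m)) \<le> \<omega> * ((1 + h * L) ^ Suc m - 1)"
    proof (rule euler_path_error[OF L cX X0 eq h(1) h(2)[symmetric]])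
      show "norm (X r - X r') \<le> \<omega>" if "r \<in> {0..t}" "r' \<in> {0..t}" "\<bar>r - r'\<bar> \<le> h" for r r'
        using \<delta>(2)[of r' r] that h\<delta> by (simp add: dist_norm)
    qed (auto simp: w_def)
    also have "\<dots> \<le> \<omega> * exp (t * L)"
    proof -
      have "(1 + h * L) ^ Suc m \<le> exp (h * L) ^ Suc m"
        using h L0 by (intro power_mono exp_ge_add_one_self) auto
      also have "\<dots> = exp (real (Suc m) * (h * L))" by (rule exp_of_nat_mult[symmetric])
      also have "real (Suc m) * (h * L) = t * L" by (simp only: mult.assoc[symmetric] h(2))
      finally show ?thesis using \<omega> by (intro mult_left_mono) auto
    qed
    also have "\<dots> < r" using r by (simp add: \<omega>_def)
    finally show "norm ((let h = t / real (Suc m) in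
      euler_path (\<lambda>y. y - h *\<^sub>R b y) x (\<lambda>j. n (real (Suc j) * h) - n (real j * h)) (Suc m)) - X t) < r"
      unfolding Let_def h_def[symmetric] w_def[symmetric] h(2) by (simp add: norm_minus_commute)
  qed
qed

section \<open>Hellinger distance, total variation and relative entropy\<close>

text \<open>
  Real-valued densities are more convenient than the extended ones that enter the definition of the
  Hellinger distance.
\<close>

lemma densities_wrt_measure_add:
  assumes "prob_space \<nu>" "prob_space \<mu>" and sets: "sets \<nu> = sets \<mu>"
  shows "\<exists>p q. p \<in> borel_measurable (measure_add \<nu> \<mu>) \<and> q \<in> borel_measurable (measure_add \<nu> \<mu>)
    \<and> (\<forall>x. 0 \<le> p x) \<and> (\<forall>x. 0 \<le> q x)
    \<and> \<nu> = density (measure_add \<nu> \<mu>) (\<lambda>x. ennreal (p x)) \<and> \<mu> = density (measure_add \<nu> \<mu>) (\<lambda>x. ennreal (q x))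
    \<and> hellinger2_sq \<nu> \<mu> = (\<integral>\<^sup>+ x. ennreal ((sqrt (q x) - sqrt (p x))\<^sup>2) \<partial>measure_add \<nu> \<mu>)"
proof -
  interpret n: prob_space \<nu> by fact
  interpret m: prob_space \<mu> by fact
  define s where "s = measure_add \<nu> \<mu>"
  have ss: "sets s = sets \<nu>" "sets s = sets \<mu>" and sp: "space s = space \<nu>" "space s = space \<mu>"
    using sets sets_eq_imp_space_eq[OF sets] by (auto simp: s_def)
  have es: "emeasure s A = emeasure \<nu> A + emeasure \<mu> A" if "A \<in> sets s" for A
    using emeasure_measure_add[OF sets, of A] that by (simp add: s_def)
  interpret s: finite_measure s
  proof
    have "emeasure s (space s) = emeasure \<nu> (space \<nu>) + emeasure \<mu> (space \<mu>)"
      using es[OF sets.top] by (simp add: sp(1)) (simp add: sp(1)[symmetric] sp(2))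
    then show "emeasure s (space s) \<noteq> \<infinity>"
      by (simp add: n.emeasure_space_1 m.emeasure_space_1)
  qed
  have ac: "absolutely_continuous s \<nu>" "absolutely_continuous s \<mu>"
    using es ss by (auto simp: absolutely_continuous_def null_sets_def)
  have D: "\<tau> = density s (\<lambda>x. ennreal (enn2real (RN_deriv s \<tau> x)))"
    if ac: "absolutely_continuous s \<tau>" and st: "sets \<tau> = sets s" and pr: "prob_space \<tau>" for \<tau>
  proof -
    interpret t: prob_space \<tau> by fact
    have "AE x in s. RN_deriv s \<tau> x \<noteq> \<infinity>"
      by (rule s.RN_deriv_finite[OF _ ac st]) (rule t.sigma_finite_measure_axioms)
    then have "density s (\<lambda>x. ennreal (enn2real (RN_deriv s \<tau> x))) = density s (RN_deriv s \<tau>)"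
      by (intro density_cong) (auto simp: ennreal_enn2real_if)
    then show ?thesis
      using s.density_RN_deriv[OF ac st] by simp
  qed
  show ?thesis
    unfolding s_def[symmetric]
  proof (intro exI conjI allI)
    show "\<nu> = density s (\<lambda>x. ennreal (enn2real (RN_deriv s \<nu> x)))"
      by (rule D) (use ac ss assms in auto)
    show "\<mu> = density s (\<lambda>x. ennreal (enn2real (RN_deriv s \<mu> x)))"
      by (rule D) (use ac ss assms in auto)
    show "hellinger2_sq \<nu> \<mu> = (\<integral>\<^sup>+ x. ennreal ((sqrt (enn2real (RN_deriv s \<mu> x)) - sqrt (enn2real (RN_deriv s \<nu> x)))\<^sup>2) \<partial>s)"
      by (simp add: hellinger2_sq_def hellinger2_sq_wrt_def s_def)
  qed auto
qed

lemma integrable_density_prob: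
  assumes "prob_space (density m (\<lambda>x. ennreal (p x)))" and p [measurable]: "p \<in> borel_measurable m" "\<And>x. 0 \<le> (p x :: real)"
  shows "integrable m p" "(\<integral>x. p x \<partial>m) = 1"
proof -
  have "(\<integral>\<^sup>+x. ennreal (p x) \<partial>m) = emeasure (density m (\<lambda>x. ennreal (p x))) (space (density m (\<lambda>x. ennreal (p x))))"
    by (simp add: emeasure_density)
  also have "\<dots> = 1" by (rule prob_space.emeasure_space_1) fact
  finally have 1: "(\<integral>\<^sup>+x. ennreal (p x) \<partial>m) = 1" .
  show "integrable m p" by (rule integrableI_nonneg) (auto simp: p 1)
  show "(\<integral>x. p x \<partial>m) = 1" using 1 by (simp add: integral_eq_nn_integral p)
qed

text \<open>
  By the Donsker--Varadhan formula the hypothesis says that the relative entropy of \<open>\<nu>\<close> with respect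
  to \<open>\<mu>\<close> is at most \<open>C\<close>, and \<open>ln r \<le> r - 1\<close> for \<open>r = sqrt (q / p)\<close> bounds the squared Hellinger
  distance by the entropy. The optimal test function \<open>ln (p / q)\<close> is unbounded; it is replaced by
  a bounded one that depends on \<open>\<epsilon>\<close>, and then \<open>\<epsilon> \<rightarrow> 0\<close>.
\<close>

lemma hellinger_le_entropy_bound:
  fixes \<nu> \<mu> :: "'b measure"
  assumes n: "prob_space \<nu>" and m: "prob_space \<mu>" and sets: "sets \<nu> = sets \<mu>"
    and DV: "\<And>\<phi> B. \<phi> \<in> borel_measurable \<mu> \<Longrightarrow> (\<And>x. \<bar>\<phi> x\<bar> \<le> B) \<Longrightarrow>
      (\<integral>x. \<phi> x \<partial>\<nu>) \<le> ln (\<integral>x. exp (\<phi> x) \<partial>\<mu>) + (C :: real)"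
  shows "hellinger2_sq \<nu> \<mu> \<le> ennreal C"
proof -
  define s where "s = measure_add \<nu> \<mu>"
  obtain p q where pq [measurable]: "p \<in> borel_measurable s" "q \<in> borel_measurable s"
    and nn: "\<And>x. 0 \<le> p x" "\<And>x. 0 \<le> q x"
    and d: "\<nu> = density s (\<lambda>x. ennreal (p x))" "\<mu> = density s (\<lambda>x. ennreal (q x))"
    and h: "hellinger2_sq \<nu> \<mu> = (\<integral>\<^sup>+ x. ennreal ((sqrt (q x) - sqrt (p x))\<^sup>2) \<partial>s)"
    using densities_wrt_measure_add[OF n m sets] unfolding s_def by blast
  have ip: "integrable s p" "(\<integral>x. p x \<partial>s) = 1"
    using integrable_density_prob[OF n[unfolded d(1)]] nn by auto
  have iq: "integrable s q" "(\<integral>x. q x \<partial>s) = 1"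
    using integrable_density_prob[OF m[unfolded d(2)]] nn by auto
  have ir: "integrable s (\<lambda>x. sqrt (p x * q x))"
  proof (rule Bochner_Integration.integrable_bound)
    show "integrable s (\<lambda>x. p x + q x)" using ip iq by simp
    have "sqrt (p x * q x) \<le> p x + q x" for x
      using nn[of x] by (intro order_trans[OF arith_geo_mean_sqrt[OF nn(1)[of x] nn(2)[of x]]]) simp
    then show "AE x in s. norm (sqrt (p x * q x)) \<le> norm (p x + q x)"
      using nn by simp
  qed simp
  have ms: "sets \<mu> = sets s" using d(2) by (metis sets_density)
  define A where "A = (\<integral>x. sqrt (p x * q x) \<partial>s)"
  have key: "2 - 2 * A \<le> C + \<epsilon> + 2 * sqrt \<epsilon>" if \<epsilon>: "0 < \<epsilon>" "\<epsilon> < 1" for \<epsilon> :: real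
  proof -
    \<comment> \<open>A quotient with values in \<open>[\<epsilon>, 1 / \<epsilon>]\<close> wherever \<open>p\<close> and \<open>q\<close> do not both vanish. If they
        do, then \<open>f x = 0\<close> by division by zero and \<open>ln 0 = 0\<close>, so \<open>\<phi>\<close> is bounded everywhere.\<close>
    define f where "f x = (p x + \<epsilon> * q x) / (q x + \<epsilon> * p x)" for x
    define \<phi> where "\<phi> x = ln (f x)" for x
    have [measurable]: "\<phi> \<in> borel_measurable s" unfolding \<phi>_def f_def by measurable
    have pos: "0 < p x + \<epsilon> * q x" "0 < q x + \<epsilon> * p x" if "p x \<noteq> 0 \<or> q x \<noteq> 0" for x
      using that nn[of x] \<epsilon> by (smt (verit) mult_pos_pos mult_nonneg_nonneg)+
    have fb: "\<epsilon> \<le> f x" "f x \<le> 1 / \<epsilon>" if "p x \<noteq> 0 \<or> q x \<noteq> 0" for x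
    proof -
      have "\<epsilon> * \<epsilon> * p x \<le> p x" using nn[of x] \<epsilon> by (intro mult_left_le_one_le) (auto simp: mult_le_one)
      moreover have "\<epsilon> * \<epsilon> * q x \<le> q x" using nn[of x] \<epsilon> by (intro mult_left_le_one_le) (auto simp: mult_le_one)
      ultimately show "\<epsilon> \<le> f x" "f x \<le> 1 / \<epsilon>"
        using pos[OF that] \<epsilon> by (auto simp: f_def field_simps)
    qed
    have bd: "\<bar>\<phi> x\<bar> \<le> - ln \<epsilon>" for x
    proof (cases "p x \<noteq> 0 \<or> q x \<noteq> 0")
      case True
      have "ln \<epsilon> \<le> ln (f x)" "ln (f x) \<le> ln (1 / \<epsilon>)"
        using fb[OF True] \<epsilon> by (auto intro!: ln_mono)
      then show ?thesis using \<epsilon> by (simp add: \<phi>_def ln_div abs_le_iff)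
    next
      case False
      then show ?thesis using \<epsilon> by (simp add: \<phi>_def f_def)
    qed
    have I: "(\<integral>x. \<phi> x \<partial>\<nu>) \<le> ln (\<integral>x. exp (\<phi> x) \<partial>\<mu>) + C"
      by (rule DV[OF _ bd]) (simp add: measurable_cong_sets[OF ms refl])
    have ib: "integrable s (\<lambda>x. p x * \<phi> x)"
      by (rule Bochner_Integration.integrable_bound[OF integrable_mult_left[OF ip(1), of "- ln \<epsilon>"]])
         (use nn mult_left_mono[OF order_trans[OF bd abs_ge_self] nn(1)] in \<open>auto simp: abs_mult\<close>)
    have "2 - 2 * A - 2 * sqrt \<epsilon> = (\<integral>x. 2 * p x - 2 * sqrt (p x * q x) - 2 * sqrt \<epsilon> * p x \<partial>s)"
      using ip ir by (simp add: A_def)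
    also have "\<dots> \<le> (\<integral>x. p x * \<phi> x \<partial>s)"
    proof (rule integral_mono[OF _ ib])
      show "integrable s (\<lambda>x. 2 * p x - 2 * sqrt (p x * q x) - 2 * sqrt \<epsilon> * p x)"
        using ip ir by simp
      show "2 * p x - 2 * sqrt (p x * q x) - 2 * sqrt \<epsilon> * p x \<le> p x * \<phi> x" for x
      proof (cases "p x = 0")
        case False
        then have p: "0 < p x" using nn[of x] by simp
        have P: "0 < p x + \<epsilon> * q x" "0 < q x + \<epsilon> * p x" using pos[of x] False by auto
        define r where "r = sqrt (1 / f x)"
        have fp: "0 < f x" using P by (simp add: f_def)
        have "\<phi> x = - 2 * ln r"
          using fp by (simp add: \<phi>_def r_def ln_sqrt ln_div)
        moreover have "ln r \<le> r - 1" using fp by (intro ln_le_minus_one) (simp add: r_def)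
        ultimately have "\<phi> x \<ge> 2 - 2 * r" by simp
        then have 1: "p x * \<phi> x \<ge> p x * (2 - 2 * r)" using p by (intro mult_left_mono) auto
        have "p x * r = sqrt (p x * p x * ((q x + \<epsilon> * p x) / (p x + \<epsilon> * q x)))"
          using p by (simp add: r_def f_def real_sqrt_mult real_sqrt_divide)
        also have "\<dots> \<le> sqrt (p x * (q x + \<epsilon> * p x))"
        proof -
          have "p x * p x * ((q x + \<epsilon> * p x) / (p x + \<epsilon> * q x)) = p x * (q x + \<epsilon> * p x) * (p x / (p x + \<epsilon> * q x))"
            by simp
          also have "\<dots> \<le> p x * (q x + \<epsilon> * p x) * 1"
            using P p nn[of x] \<epsilon> by (intro mult_left_mono) (auto simp: field_simps)
          finally show ?thesis by simp
        qed
        also have "\<dots> = sqrt (p x * q x + \<epsilon> * (p x)\<^sup>2)" by (simp add: algebra_simps power2_eq_square)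
        also have "\<dots> \<le> sqrt (p x * q x) + sqrt (\<epsilon> * (p x)\<^sup>2)"
          using nn[of x] \<epsilon> by (intro sqrt_add_le_add_sqrt) auto
        also have "sqrt (\<epsilon> * (p x)\<^sup>2) = sqrt \<epsilon> * p x"
          using p by (simp add: real_sqrt_mult)
        finally show ?thesis using 1 by (simp add: algebra_simps)
      qed simp
    qed
    also have "\<dots> = (\<integral>x. \<phi> x \<partial>\<nu>)"
      unfolding d(1) by (subst integral_density) (auto simp: nn)
    finally have L: "2 - 2 * A - 2 * sqrt \<epsilon> \<le> (\<integral>x. \<phi> x \<partial>\<nu>)" .
    have "(\<integral>x. exp (\<phi> x) \<partial>\<mu>) = (\<integral>x. q x * exp (\<phi> x) \<partial>s)"
      unfolding d(2) by (subst integral_density) (auto simp: nn)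
    also have "\<dots> \<le> (\<integral>x. p x + \<epsilon> * q x \<partial>s)"
    proof (rule integral_mono)
      show "integrable s (\<lambda>x. p x + \<epsilon> * q x)" using ip iq by simp
      have e: "exp (\<phi> x) \<le> exp (- ln \<epsilon>)" for x using bd[of x] by (simp add: abs_le_iff)
      show "integrable s (\<lambda>x. q x * exp (\<phi> x))"
        by (rule Bochner_Integration.integrable_bound[OF integrable_mult_left[OF iq(1), of "exp (- ln \<epsilon>)"]])
           (use e nn in \<open>auto simp: abs_mult intro!: mult_left_mono\<close>)
      show "q x * exp (\<phi> x) \<le> p x + \<epsilon> * q x" for x
      proof (cases "q x = 0")
        case False
        then have P: "0 < p x + \<epsilon> * q x" "0 < q x + \<epsilon> * p x" using pos[of x] by auto
        then have "q x * exp (\<phi> x) = (p x + \<epsilon> * q x) * (q x / (q x + \<epsilon> * p x))"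
          by (simp add: \<phi>_def f_def)
        also have "\<dots> \<le> (p x + \<epsilon> * q x) * 1"
          using P nn[of x] \<epsilon> by (intro mult_left_mono) (auto simp: field_simps)
        finally show ?thesis by simp
      qed (use nn \<epsilon> in simp)
    qed
    also have "\<dots> = 1 + \<epsilon>" using ip iq by simp
    finally have U: "(\<integral>x. exp (\<phi> x) \<partial>\<mu>) \<le> 1 + \<epsilon>" .
    have "ln (\<integral>x. exp (\<phi> x) \<partial>\<mu>) \<le> \<epsilon>"
    proof (cases "0 < (\<integral>x. exp (\<phi> x) \<partial>\<mu>)")
      case True
      with ln_le_minus_one[OF True] U show ?thesis by simp
    next
      case False
      moreover have "0 \<le> (\<integral>x. exp (\<phi> x) \<partial>\<mu>)" by (rule integral_nonneg_AE) simp
      ultimately show ?thesis using \<epsilon> by simp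
    qed
    with L I show ?thesis by linarith
  qed
  have "2 - 2 * A \<le> C"
  proof (rule tendsto_lowerbound)
    show "((\<lambda>\<epsilon>. C + \<epsilon> + 2 * sqrt \<epsilon>) \<longlongrightarrow> C) (at_right 0)"
      by (rule tendsto_eq_intros | simp)+
    show "\<forall>\<^sub>F \<epsilon> in at_right 0. 2 - 2 * A \<le> C + \<epsilon> + 2 * sqrt \<epsilon>"
      using eventually_at_right_real[OF zero_less_one] by eventually_elim (auto intro!: key)
  qed simp
  moreover have "hellinger2_sq \<nu> \<mu> = ennreal (2 - 2 * A)"
  proof -
    have sq: "(sqrt (q x) - sqrt (p x))\<^sup>2 = p x + q x - 2 * sqrt (p x * q x)" for x
      using nn[of x] by (simp add: power2_diff real_sqrt_mult)
    have i: "integrable s (\<lambda>x. p x + q x - 2 * sqrt (p x * q x))" using ip iq ir by simp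
    have "hellinger2_sq \<nu> \<mu> = ennreal (\<integral>x. p x + q x - 2 * sqrt (p x * q x) \<partial>s)"
      unfolding h sq by (rule nn_integral_eq_integral[OF i]) (simp add: sq[symmetric])
    then show ?thesis using ip iq ir by (simp add: A_def)
  qed
  ultimately show ?thesis by (simp add: ennreal_leI)
qed

text \<open>
  The free parameter \<open>a\<close> comes from the inequality between the arithmetic and the geometric mean,
  which takes the place of the Cauchy--Schwarz inequality for
  \<open>|p - q| = |sqrt p - sqrt q| \<cdot> (sqrt p + sqrt q)\<close>.
\<close>

lemma total_variation_le_hellinger:
  assumes n: "prob_space \<nu>" and m: "prob_space \<mu>" and sets: "sets \<nu> = sets \<mu>"
    and H: "hellinger2_sq \<nu> \<mu> \<le> ennreal H" "0 \<le> H" and a: "0 < a"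
  shows "total_variation \<nu> \<mu> \<le> (a * H + 4 / a) / 2" "0 \<le> total_variation \<nu> \<mu>"
proof -
  interpret n: prob_space \<nu> by fact
  interpret m: prob_space \<mu> by fact
  define s where "s = measure_add \<nu> \<mu>"
  obtain p q where pq [measurable]: "p \<in> borel_measurable s" "q \<in> borel_measurable s"
    and nn: "\<And>x. 0 \<le> p x" "\<And>x. 0 \<le> q x"
    and d: "\<nu> = density s (\<lambda>x. ennreal (p x))" "\<mu> = density s (\<lambda>x. ennreal (q x))"
    and h: "hellinger2_sq \<nu> \<mu> = (\<integral>\<^sup>+ x. ennreal ((sqrt (q x) - sqrt (p x))\<^sup>2) \<partial>s)"
    using densities_wrt_measure_add[OF n m sets] unfolding s_def by blast
  have ip: "integrable s p" "(\<integral>x. p x \<partial>s) = 1"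
    using integrable_density_prob[OF n[unfolded d(1)]] nn by auto
  have iq: "integrable s q" "(\<integral>x. q x \<partial>s) = 1"
    using integrable_density_prob[OF m[unfolded d(2)]] nn by auto
  have ih: "integrable s (\<lambda>x. (sqrt (q x) - sqrt (p x))\<^sup>2)"
    by (rule integrableI_nonneg) (use H(1) in \<open>auto simp: h intro: order.strict_trans1\<close>)
  have Hh: "(\<integral>x. (sqrt (q x) - sqrt (p x))\<^sup>2 \<partial>s) \<le> H"
    using H unfolding h by (subst (asm) nn_integral_eq_integral[OF ih]) auto
  have B: "\<bar>measure \<nu> A - measure \<mu> A\<bar> \<le> (a * H + 4 / a) / 2" if A: "A \<in> sets \<nu>" for A
  proof -
    have As [measurable]: "A \<in> sets s" using A by (simp add: s_def)
    have M: "measure (density s (\<lambda>x. ennreal (r x))) A = (\<integral>x. r x * indicator A x \<partial>s)"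
      if "\<And>x. 0 \<le> r x" "integrable s r" for r
    proof -
      have "measure (density s (\<lambda>x. ennreal (r x))) A = (\<integral>x. indicator A x \<partial>density s (\<lambda>x. ennreal (r x)))"
        using sets.sets_into_space[OF As] by (simp add: Int_absorb2)
      then show ?thesis using that by (subst (asm) integral_density) auto
    qed
    have i: "integrable s (\<lambda>x. p x * indicator A x)" "integrable s (\<lambda>x. q x * indicator A x)"
      using ip iq by (auto intro: integrable_real_mult_indicator)
    have "measure \<nu> A - measure \<mu> A = (\<integral>x. p x * indicator A x - q x * indicator A x \<partial>s)"
      unfolding d using i by (simp add: M nn ip iq)
    also have "\<bar>\<dots>\<bar> \<le> (\<integral>x. \<bar>p x * indicator A x - q x * indicator A x\<bar> \<partial>s)"
      by (rule integral_abs_bound)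
    also have "\<dots> \<le> (\<integral>x. (a * (sqrt (q x) - sqrt (p x))\<^sup>2 + (2 * p x + 2 * q x) / a) / 2 \<partial>s)"
    proof (rule integral_mono)
      show "integrable s (\<lambda>x. \<bar>p x * indicator A x - q x * indicator A x\<bar>)" using i by simp
      show "integrable s (\<lambda>x. (a * (sqrt (q x) - sqrt (p x))\<^sup>2 + (2 * p x + 2 * q x) / a) / 2)"
        using ih ip iq by simp
      fix x
      define u where "u = sqrt (q x)"
      define v where "v = sqrt (p x)"
      have uv: "0 \<le> u" "0 \<le> v" "q x = u\<^sup>2" "p x = v\<^sup>2" using nn[of x] by (auto simp: u_def v_def)
      have "\<bar>p x * indicator A x - q x * indicator A x\<bar> \<le> \<bar>p x - q x\<bar>"
        by (simp split: split_indicator)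
      also have "p x - q x = (v - u) * (u + v)"
        unfolding uv(3,4) by (simp add: power2_eq_square algebra_simps)
      also have "\<bar>(v - u) * (u + v)\<bar> = \<bar>u - v\<bar> * (u + v)"
        using uv(1,2) by (simp add: abs_mult abs_minus_commute)
      also have "\<dots> \<le> (a * (u - v)\<^sup>2 + (u + v)\<^sup>2 / a) / 2"
      proof -
        have "0 \<le> (a * \<bar>u - v\<bar> - (u + v))\<^sup>2" by simp
        also have "\<dots> = a * (a * (u - v)\<^sup>2 + (u + v)\<^sup>2 / a - 2 * (\<bar>u - v\<bar> * (u + v)))"
          using a by (simp add: power2_diff power_mult_distrib field_simps power2_eq_square)
        finally show ?thesis using a by (simp add: zero_le_mult_iff)
      qed
      also have "\<dots> \<le> (a * (u - v)\<^sup>2 + (2 * p x + 2 * q x) / a) / 2"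
      proof -
        have "(u + v)\<^sup>2 \<le> 2 * p x + 2 * q x"
          unfolding uv using zero_le_power2[of "u - v"] by (simp add: power2_sum power2_diff)
        then show ?thesis using a by (simp add: divide_right_mono)
      qed
      finally show "\<bar>p x * indicator A x - q x * indicator A x\<bar> \<le> (a * (sqrt (q x) - sqrt (p x))\<^sup>2 + (2 * p x + 2 * q x) / a) / 2"
        by (simp add: u_def v_def)
    qed
    also have "\<dots> = (a * (\<integral>x. (sqrt (q x) - sqrt (p x))\<^sup>2 \<partial>s) + 4 / a) / 2"
      using ih ip iq by simp
    also have "\<dots> \<le> (a * H + 4 / a) / 2"
      using Hh a by simp
    finally show ?thesis .
  qed
  show "total_variation \<nu> \<mu> \<le> (a * H + 4 / a) / 2"
    unfolding total_variation_def by (rule cSUP_least) (use B in auto)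
  have "\<bar>measure \<nu> {} - measure \<mu> {}\<bar> \<le> total_variation \<nu> \<mu>"
    unfolding total_variation_def by (rule cSUP_upper[OF _ bdd_aboveI2[OF B]]) auto
  then show "0 \<le> total_variation \<nu> \<mu>" by simp
qed

section \<open>Reduction to continuous test functions\<close>

text \<open>
  By regularity of \<open>m\<close>, a Borel set lies between a compact and an open set whose difference has small
  measure, and a Urysohn function for this pair is close to its indicator.
\<close>

lemma L1_continuous_approximation:
  fixes f :: "'b::euclidean_space \<Rightarrow> real"
  assumes fin: "finite_measure m" and sets [simp]: "sets m = sets borel" and f: "integrable m f" and e: "0 < e"
  shows "\<exists>g. continuous_on UNIV g \<and> (\<integral>\<^sup>+x. ennreal \<bar>f x - g x\<bar> \<partial>m) < ennreal e"
  using f e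
proof (induction f arbitrary: e rule: integrable_induct)
  case (base A c)
  interpret finite_measure m by (rule fin)
  have A [measurable]: "A \<in> sets borel" using base by simp
  have sp [simp]: "space m = UNIV" using sets_eq_imp_space_eq[OF sets] by simp
  define d where "d = e / (2 * (\<bar>c\<bar> + 1))"
  have d: "0 < d" using base by (simp add: d_def)
  have mA: "emeasure m A = ennreal (measure m A)" by (simp add: emeasure_eq_measure)
  obtain K where K: "K \<subseteq> A" "compact K" "measure m A < measure m K + d"
  proof -
    have "\<exists>K\<in>{K. K \<subseteq> A \<and> compact K}. emeasure m A < emeasure m K + ennreal d"
    proof (rule ccontr)
      assume "\<not> ?thesis"
      then have *: "emeasure m K + ennreal d \<le> emeasure m A" if "K \<subseteq> A" "compact K" for K using that by force
      have "measure m K \<le> measure m A - d" if "K \<subseteq> A" "compact K" for K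
        using *[OF that] d by (simp add: emeasure_eq_measure ennreal_plus[symmetric] del: ennreal_plus)
      moreover from this[of "{}"] have "0 \<le> measure m A - d" by simp
      ultimately have "(SUP K\<in>{K. K \<subseteq> A \<and> compact K}. emeasure m K) \<le> ennreal (measure m A - d)"
        by (intro SUP_least) (auto simp: emeasure_eq_measure ennreal_leI)
      then have "ennreal (measure m A) \<le> ennreal (measure m A - d)"
        using inner_regular[OF sets _ A] mA by (simp add: emeasure_finite)
      then show False using d \<open>0 \<le> measure m A - d\<close> by simp
    qed
    then show ?thesis using that d by (auto simp: emeasure_eq_measure ennreal_plus[symmetric] ennreal_less_iff simp del: ennreal_plus)
  qed
  obtain V where V: "A \<subseteq> V" "open V" "measure m V < measure m A + d"
  proof -
    have "emeasure m A = (INF V\<in>{V. A \<subseteq> V \<and> open V}. emeasure m V)"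
      by (rule outer_regular[OF sets _ A]) simp
    moreover have "emeasure m A < ennreal (measure m A + d)"
      using d by (simp add: mA ennreal_less_iff)
    ultimately have "(INF V\<in>{V. A \<subseteq> V \<and> open V}. emeasure m V) < ennreal (measure m A + d)"
      by (simp only:)
    then obtain V where "A \<subseteq> V" "open V" "emeasure m V < ennreal (measure m A + d)"
      unfolding INF_less_iff by auto
    then show ?thesis using that by (simp add: emeasure_eq_measure ennreal_less_iff)
  qed
  have meas [measurable]: "K \<in> sets borel" "V \<in> sets borel"
    using K(2) V(2) by (auto intro: borel_compact borel_open)
  have KV: "measure m (V - K) < 2 * d"
  proof -
    have "measure m (V - K) = measure m V - measure m K"
      using K(1) V(1) meas by (intro finite_measure_Diff) auto
    then show ?thesis using K(3) V(3) by linarith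
  qed
  obtain u :: "'b \<Rightarrow> real" where u: "continuous_on UNIV u" "\<And>x. u x \<in> closed_segment 1 0"
    "\<And>x. x \<in> K \<Longrightarrow> u x = 1" "\<And>x. x \<in> - V \<Longrightarrow> u x = 0"
    by (rule Urysohn[of K "- V" 1 "0 :: real"]) (use K V compact_imp_closed in auto)
  have u01: "0 \<le> u x" "u x \<le> 1" for x using u(2)[of x] by (auto simp: closed_segment_eq_real_ivl split: if_splits)
  have "(\<integral>\<^sup>+x. ennreal \<bar>indicator A x *\<^sub>R c - u x * c\<bar> \<partial>m) \<le> (\<integral>\<^sup>+x. ennreal \<bar>c\<bar> * indicator (V - K) x \<partial>m)"
  proof (intro nn_integral_mono)
    fix x
    have "indicator A x *\<^sub>R c - u x * c = (indicator A x - u x) * c" by (simp add: algebra_simps)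
    moreover have "\<bar>indicator A x - u x\<bar> \<le> indicator (V - K) x"
      using u01[of x] u(3,4)[of x] K(1) V(1) by (auto split: split_indicator)
    ultimately have "\<bar>indicator A x *\<^sub>R c - u x * c\<bar> \<le> indicator (V - K) x * \<bar>c\<bar>"
      by (simp add: abs_mult mult_right_mono)
    then show "ennreal \<bar>indicator A x *\<^sub>R c - u x * c\<bar> \<le> ennreal \<bar>c\<bar> * indicator (V - K) x"
      by (auto intro!: ennreal_leI split: split_indicator)
  qed
  also have "\<dots> = ennreal (\<bar>c\<bar> * measure m (V - K))"
    using meas by (subst nn_integral_cmult_indicator) (auto simp: emeasure_eq_measure ennreal_mult')
  also have "\<dots> < ennreal e"
  proof -
    have "\<bar>c\<bar> * measure m (V - K) \<le> \<bar>c\<bar> * (2 * d)" using KV by (intro mult_left_mono) auto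
    also have "\<dots> < e" using base by (simp add: d_def field_simps)
    finally show ?thesis using base by (simp add: ennreal_less_iff)
  qed
  finally show ?case using u(1) by (intro exI[of _ "\<lambda>x. u x * c"]) (auto intro!: continuous_intros)
next
  case (add f g)
  note [measurable_cong] = sets
  obtain f' where f': "continuous_on UNIV f'" "(\<integral>\<^sup>+x. ennreal \<bar>f x - f' x\<bar> \<partial>m) < ennreal (e / 2)"
    using add.IH(1)[of "e / 2"] add.prems by auto
  obtain g' where g': "continuous_on UNIV g'" "(\<integral>\<^sup>+x. ennreal \<bar>g x - g' x\<bar> \<partial>m) < ennreal (e / 2)"
    using add.IH(2)[of "e / 2"] add.prems by auto
  have [measurable]: "f' \<in> borel_measurable borel" "g' \<in> borel_measurable borel"
    using f' g' by (auto intro: borel_measurable_continuous_onI)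
  have [measurable]: "f \<in> borel_measurable m" "g \<in> borel_measurable m" using add by auto
  have "(\<integral>\<^sup>+x. ennreal \<bar>(f x + g x) - (f' x + g' x)\<bar> \<partial>m) \<le> (\<integral>\<^sup>+x. ennreal \<bar>f x - f' x\<bar> + ennreal \<bar>g x - g' x\<bar> \<partial>m)"
    by (intro nn_integral_mono) (auto simp: ennreal_plus[symmetric] simp del: ennreal_plus intro!: ennreal_leI)
  also have "\<dots> = (\<integral>\<^sup>+x. ennreal \<bar>f x - f' x\<bar> \<partial>m) + (\<integral>\<^sup>+x. ennreal \<bar>g x - g' x\<bar> \<partial>m)"
    by (rule nn_integral_add) measurable
  also have "\<dots> < ennreal (e / 2) + ennreal (e / 2)" using f'(2) g'(2) by (rule add_strict_mono)
  also have "\<dots> = ennreal e" using add by (simp add: ennreal_plus[symmetric] del: ennreal_plus)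
  finally show ?case using f' g' by (intro exI[of _ "\<lambda>x. f' x + g' x"]) (auto intro!: continuous_intros)
next
  case (lim f s)
  note [measurable_cong] = sets
  have [measurable]: "f \<in> borel_measurable m" "\<And>i. s i \<in> borel_measurable m" using lim by auto
  have "(\<lambda>i. \<integral>\<^sup>+x. norm (f x - s i x) \<partial>m) \<longlonglongrightarrow> 0"
    by (rule nn_integral_dominated_convergence_norm[where w = "\<lambda>x. 2 * norm (f x)"])
       (use lim in \<open>auto simp: integrable_iff_bounded ennreal_mult nn_integral_cmult ennreal_mult_less_top\<close>)
  then have "\<forall>\<^sub>F i in sequentially. (\<integral>\<^sup>+x. norm (f x - s i x) \<partial>m) < ennreal (e / 2)"
    using lim by (intro order_tendstoD) auto
  then obtain i where i: "(\<integral>\<^sup>+x. norm (f x - s i x) \<partial>m) < ennreal (e / 2)"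
    by (auto simp: eventually_sequentially)
  obtain g where g: "continuous_on UNIV g" "(\<integral>\<^sup>+x. ennreal \<bar>s i x - g x\<bar> \<partial>m) < ennreal (e / 2)"
    using lim.IH[of "e / 2" i] lim.prems by auto
  have [measurable]: "g \<in> borel_measurable borel" using g by (auto intro: borel_measurable_continuous_onI)
  have "(\<integral>\<^sup>+x. ennreal \<bar>f x - g x\<bar> \<partial>m) \<le> (\<integral>\<^sup>+x. norm (f x - s i x) + ennreal \<bar>s i x - g x\<bar> \<partial>m)"
    by (intro nn_integral_mono) (auto simp: ennreal_plus[symmetric] simp del: ennreal_plus intro!: ennreal_leI)
  also have "\<dots> = (\<integral>\<^sup>+x. norm (f x - s i x) \<partial>m) + (\<integral>\<^sup>+x. ennreal \<bar>s i x - g x\<bar> \<partial>m)"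
    by (rule nn_integral_add) measurable
  also have "\<dots> < ennreal (e / 2) + ennreal (e / 2)" using i g(2) by (rule add_strict_mono)
  also have "\<dots> = ennreal e" using lim by (simp add: ennreal_plus[symmetric] del: ennreal_plus)
  finally show ?case using g(1) by blast
qed

text \<open>
  Weak convergence gives the entropy inequality for continuous test functions only. Both sides
  are continuous along uniformly bounded sequences that converge in \<open>L\<^sup>1(\<nu> + \<mu>)\<close>, and the continuous
  functions are dense there.
\<close>

lemma entropy_bound_extend:
  fixes \<nu> \<mu> :: "'b::euclidean_space measure"
  assumes n: "prob_space \<nu>" and m: "prob_space \<mu>" and sets: "sets \<nu> = sets borel" "sets \<mu> = sets borel"
    and DV: "\<And>\<phi> B. continuous_on UNIV \<phi> \<Longrightarrow> (\<And>x. \<bar>\<phi> x\<bar> \<le> B) \<Longrightarrow>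
      (\<integral>x. \<phi> x \<partial>\<nu>) \<le> ln (\<integral>x. exp (\<phi> x) \<partial>\<mu>) + (C :: real)"
    and \<phi>: "\<phi> \<in> borel_measurable borel" "\<And>x. \<bar>\<phi> x\<bar> \<le> B"
  shows "(\<integral>x. \<phi> x \<partial>\<nu>) \<le> ln (\<integral>x. exp (\<phi> x) \<partial>\<mu>) + C"
proof -
  interpret n: prob_space \<nu> by fact
  interpret m: prob_space \<mu> by fact
  note [measurable_cong] = sets
  note [measurable] = \<phi>(1)
  have sp [simp]: "space \<nu> = UNIV" "space \<mu> = UNIV" using sets[THEN sets_eq_imp_space_eq] by auto
  define s where "s = measure_add \<nu> \<mu>"
  have ss [simp, measurable_cong]: "sets s = sets borel" by (simp add: s_def sets)
  have es: "emeasure s A = emeasure \<nu> A + emeasure \<mu> A" if "A \<in> sets borel" for A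
    unfolding s_def by (rule emeasure_measure_add) (use that sets in auto)
  have fs: "finite_measure s"
  proof
    show "emeasure s (space s) \<noteq> \<infinity>"
      using es[of UNIV] n.emeasure_space_1 m.emeasure_space_1 by (simp add: s_def)
  qed
  interpret s: finite_measure s by (rule fs)
  have le: "\<nu> \<le> s" "\<mu> \<le> s" using es sets by (auto simp: le_measure)
  have B0: "0 \<le> B" using \<phi>(2)[of 0] by linarith
  have "integrable s \<phi>" by (rule s.integrable_const_bound[where B = B]) (auto simp: \<phi>)
  then have "\<exists>g. continuous_on UNIV g \<and> (\<integral>\<^sup>+x. ennreal \<bar>\<phi> x - g x\<bar> \<partial>s) < ennreal (1 / real (Suc i))" for i
    by (intro L1_continuous_approximation[OF fs ss]) auto
  then obtain g where g: "\<And>i. continuous_on UNIV (g i)" "\<And>i. (\<integral>\<^sup>+x. ennreal \<bar>\<phi> x - g i x\<bar> \<partial>s) < ennreal (1 / real (Suc i))"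
    by metis
  define \<psi> where "\<psi> i x = max (- B) (min B (g i x))" for i x
  have \<psi>c: "continuous_on UNIV (\<psi> i)" for i unfolding \<psi>_def by (intro continuous_intros g)
  have [measurable]: "\<psi> i \<in> borel_measurable borel" for i using \<psi>c by (rule borel_measurable_continuous_onI)
  have \<psi>b: "\<bar>\<psi> i x\<bar> \<le> B" for i x using B0 by (auto simp: \<psi>_def)
  have close: "\<bar>\<phi> x - \<psi> i x\<bar> \<le> \<bar>\<phi> x - g i x\<bar>" for i x using \<phi>(2)[of x] by (auto simp: \<psi>_def)
  have L: "(\<integral>x. \<bar>\<phi> x - \<psi> i x\<bar> \<partial>\<tau>) \<le> 1 / real (Suc i)"
    if \<tau>: "prob_space \<tau>" "sets \<tau> = sets borel" "\<tau> \<le> s" for \<tau> i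
  proof -
    have [measurable_cong]: "sets \<tau> = sets borel" by fact
    have "(\<integral>\<^sup>+x. ennreal \<bar>\<phi> x - \<psi> i x\<bar> \<partial>\<tau>) \<le> (\<integral>\<^sup>+x. ennreal \<bar>\<phi> x - g i x\<bar> \<partial>\<tau>)"
      by (intro nn_integral_mono ennreal_leI close)
    also have "\<dots> \<le> (\<integral>\<^sup>+x. ennreal \<bar>\<phi> x - g i x\<bar> \<partial>s)"
      by (rule nn_integral_mono_measure) (use \<tau> in auto)
    also have "\<dots> \<le> ennreal (1 / real (Suc i))" using g(2)[of i] by simp
    finally show ?thesis
      by (subst integral_eq_nn_integral) (auto simp: enn2real_leI)
  qed
  have i: "integrable \<tau> f" if "prob_space \<tau>" "sets \<tau> = sets borel" "f \<in> borel_measurable borel" "\<And>x. \<bar>f x\<bar> \<le> (b :: real)" for \<tau> f b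
  proof -
    interpret prob_space \<tau> by fact
    show ?thesis using that by (intro integrable_const_bound[where B = b]) (auto simp: measurable_cong_sets[OF that(2) refl])
  qed
  have exl: "\<bar>exp a - exp b\<bar> \<le> exp B * \<bar>a - b\<bar>" if "\<bar>a\<bar> \<le> B" "\<bar>b\<bar> \<le> B" for a b :: real
  proof -
    have *: "exp a - exp b \<le> exp B * \<bar>a - b\<bar>" if "\<bar>a\<bar> \<le> B" for a b :: real
    proof -
      have "1 - exp (b - a) \<le> a - b" using exp_ge_add_one_self[of "b - a"] by linarith
      then have "exp a * (1 - exp (b - a)) \<le> exp a * (a - b)" by (rule mult_left_mono) simp
      also have "\<dots> \<le> exp a * \<bar>a - b\<bar>" by (intro mult_left_mono) auto
      also have "\<dots> \<le> exp B * \<bar>a - b\<bar>" using that by (intro mult_right_mono) auto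
      finally show ?thesis by (simp add: right_diff_distrib exp_add[symmetric])
    qed
    show ?thesis using *[OF that(1), of b] *[OF that(2), of a] by (simp add: abs_le_iff abs_minus_commute)
  qed
  have lim0: "(\<lambda>i. c * (1 / real (Suc i))) \<longlonglongrightarrow> 0" for c :: real
    by (rule tendsto_mult_right_zero) (rule LIMSEQ_Suc[OF lim_1_over_n])
  have lim1: "(\<lambda>i. \<integral>x. \<psi> i x \<partial>\<nu>) \<longlonglongrightarrow> (\<integral>x. \<phi> x \<partial>\<nu>)"
  proof (rule LIM_zero_cancel, rule Lim_null_comparison[OF _ lim0[of 1]])
    show "\<forall>\<^sub>F k in sequentially. norm ((\<integral>x. \<psi> k x \<partial>\<nu>) - (\<integral>x. \<phi> x \<partial>\<nu>)) \<le> 1 * (1 / real (Suc k))"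
    proof (intro always_eventually allI)
      fix k
      have ii: "integrable \<nu> \<phi>" "integrable \<nu> (\<psi> k)" by (rule i[OF n sets(1) \<phi>], rule i[OF n sets(1) _ \<psi>b]) measurable
      have "\<bar>(\<integral>x. \<psi> k x \<partial>\<nu>) - (\<integral>x. \<phi> x \<partial>\<nu>)\<bar> = \<bar>\<integral>x. \<psi> k x - \<phi> x \<partial>\<nu>\<bar>" using ii by simp
      also have "\<dots> \<le> (\<integral>x. \<bar>\<phi> x - \<psi> k x\<bar> \<partial>\<nu>)" using integral_abs_bound[of \<nu> "\<lambda>x. \<psi> k x - \<phi> x"] by (simp add: abs_minus_commute)
      finally show "norm ((\<integral>x. \<psi> k x \<partial>\<nu>) - (\<integral>x. \<phi> x \<partial>\<nu>)) \<le> 1 * (1 / real (Suc k))" using L[OF n sets(1) le(1), of k] by simp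
    qed
  qed
  have lim2: "(\<lambda>i. \<integral>x. exp (\<psi> i x) \<partial>\<mu>) \<longlonglongrightarrow> (\<integral>x. exp (\<phi> x) \<partial>\<mu>)"
  proof (rule LIM_zero_cancel, rule Lim_null_comparison[OF _ lim0[of "exp B"]])
    show "\<forall>\<^sub>F k in sequentially. norm ((\<integral>x. exp (\<psi> k x) \<partial>\<mu>) - (\<integral>x. exp (\<phi> x) \<partial>\<mu>)) \<le> exp B * (1 / real (Suc k))"
    proof (intro always_eventually allI)
      fix k
      have ii: "integrable \<mu> (\<lambda>x. exp (\<phi> x))" "integrable \<mu> (\<lambda>x. exp (\<psi> k x))"
        by (rule i[OF m sets(2), of _ "exp B"]; use \<phi>(2) \<psi>b in \<open>simp add: abs_le_iff\<close>)+
      have ii': "integrable \<mu> \<phi>" "integrable \<mu> (\<psi> k)"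
        by (rule i[OF m sets(2) \<phi>], rule i[OF m sets(2) _ \<psi>b]) measurable
      have "\<bar>(\<integral>x. exp (\<psi> k x) \<partial>\<mu>) - (\<integral>x. exp (\<phi> x) \<partial>\<mu>)\<bar> = \<bar>\<integral>x. exp (\<psi> k x) - exp (\<phi> x) \<partial>\<mu>\<bar>" using ii by simp
      also have "\<dots> \<le> (\<integral>x. \<bar>exp (\<psi> k x) - exp (\<phi> x)\<bar> \<partial>\<mu>)" by (rule integral_abs_bound)
      also have "\<dots> \<le> (\<integral>x. exp B * \<bar>\<phi> x - \<psi> k x\<bar> \<partial>\<mu>)"
        using ii ii' exl[OF \<psi>b \<phi>(2)] by (intro integral_mono) (auto simp: abs_minus_commute)
      also have "\<dots> \<le> exp B * (1 / real (Suc k))" using mult_left_mono[OF L[OF m sets(2) le(2), of k], of "exp B"] by simp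
      finally show "norm ((\<integral>x. exp (\<psi> k x) \<partial>\<mu>) - (\<integral>x. exp (\<phi> x) \<partial>\<mu>)) \<le> exp B * (1 / real (Suc k))" by simp
    qed
  qed
  have pos: "0 < (\<integral>x. exp (\<phi> x) \<partial>\<mu>)"
  proof -
    have "exp (- B) \<le> (\<integral>x. exp (\<phi> x) \<partial>\<mu>)"
      using \<phi> by (intro m.integral_ge_const i[OF m sets(2), of _ "exp B"]) (auto simp: abs_le_iff minus_le_iff)
    then show ?thesis using exp_gt_zero[of "- B"] by linarith
  qed
  show ?thesis
  proof (rule LIMSEQ_le[OF lim1])
    show "(\<lambda>i. ln (\<integral>x. exp (\<psi> i x) \<partial>\<mu>) + C) \<longlonglongrightarrow> ln (\<integral>x. exp (\<phi> x) \<partial>\<mu>) + C"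
      using pos by (intro tendsto_intros lim2) auto
    show "\<exists>N. \<forall>k\<ge>N. (\<integral>x. \<psi> k x \<partial>\<nu>) \<le> ln (\<integral>x. exp (\<psi> k x) \<partial>\<mu>) + C"
      using DV[OF \<psi>c \<psi>b] by blast
  qed
qed

section \<open>The Langevin diffusion\<close>

lemma brownian_motionD:
  assumes "brownian_motion M v N"
  shows brownian_motion_prob_space: "prob_space M"
    and brownian_motion_measurable: "0 \<le> r \<Longrightarrow> N r \<in> borel_measurable M"
    and brownian_motion_increment: "0 \<le> r \<Longrightarrow> r < t \<Longrightarrow> distributed M lborel (\<lambda>\<omega>. N t \<omega> - N r \<omega>)
         (\<lambda>y. ennreal (\<Prod>i\<in>UNIV. normal_density 0 (sqrt (v * (t - r))) (y $ i)))"
    and brownian_motion_indep: "0 \<le> \<tau> 0 \<Longrightarrow> (\<And>i. i < k \<Longrightarrow> \<tau> i \<le> \<tau> (Suc i)) \<Longrightarrow>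
         prob_space.indep_vars M (\<lambda>_. borel) (\<lambda>i \<omega>. N (\<tau> (Suc i)) \<omega> - N (\<tau> i) \<omega>) {..<k}"
  using assms unfolding brownian_motion_def by blast+

lemma distr_brownian_increment:
  assumes "brownian_motion M 2 N" "0 \<le> r" "0 < h"
  shows "distr M borel (\<lambda>\<omega>. N (r + h) \<omega> - N r \<omega>) = gauss (sqrt (2 * h))"
proof -
  have "distr M lborel (\<lambda>\<omega>. N (r + h) \<omega> - N r \<omega>) = gauss (sqrt (2 * h))"
    using brownian_motion_increment[OF assms(1,2), of "r + h"] assms(3)
    by (simp add: distributed_def gauss_def gauss_density_def)
  then show ?thesis by (simp cong: distr_cong)
qed

text \<open>
  Every coupling with a Dirac measure is concentrated on \<open>{x} \<times> UNIV\<close>, so its cost is determined by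
  the other marginal.
\<close>

lemma second_moment_le_wasserstein:
  fixes \<mu> :: "'b::euclidean_space measure"
  shows "(\<integral>\<^sup>+y. ennreal ((norm (x - y))\<^sup>2) \<partial>\<mu>) \<le> wasserstein2_sq (return borel x) \<mu>"
  unfolding wasserstein2_sq_def
proof (rule INF_greatest)
  fix \<pi> assume "\<pi> \<in> couplings (return borel x) \<mu>"
  then have [measurable_cong]: "sets \<pi> = sets (borel \<Otimes>\<^sub>M borel)"
    and 1: "distr \<pi> borel fst = return borel x" and 2: "distr \<pi> borel snd = \<mu>"
    by (auto simp: couplings_def)
  have "AE y in distr \<pi> borel fst. y = x" unfolding 1 by (subst AE_return) auto
  then have "AE z in \<pi>. fst z = x" by (subst (asm) AE_distr_iff) auto
  then have "(\<integral>\<^sup>+z. ennreal ((norm (fst z - snd z))\<^sup>2) \<partial>\<pi>) = (\<integral>\<^sup>+z. ennreal ((norm (x - snd z))\<^sup>2) \<partial>\<pi>)"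
    by (intro nn_integral_cong_AE) auto
  also have "\<dots> = (\<integral>\<^sup>+y. ennreal ((norm (x - y))\<^sup>2) \<partial>\<mu>)"
    unfolding 2[symmetric] by (subst nn_integral_distr) auto
  finally show "(\<integral>\<^sup>+y. ennreal ((norm (x - y))\<^sup>2) \<partial>\<mu>) \<le> (\<integral>\<^sup>+z. ennreal ((norm (fst z - snd z))\<^sup>2) \<partial>\<pi>)"
    by simp
qed

lemma (in prob_space) expectation_ln_le:
  assumes i: "integrable M f" "integrable M (\<lambda>x. ln (f x))" and f: "\<And>x. l \<le> f x" "(0 :: real) < l"
  shows "expectation (\<lambda>x. ln (f x)) \<le> ln (expectation f)"
proof -
  define a where "a = expectation f"
  have "l \<le> a" unfolding a_def by (rule integral_ge_const[OF i(1)]) (simp add: f)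
  then have a: "0 < a" using f(2) by linarith
  have "ln (f x) \<le> ln a + (f x - a) / a" for x
  proof -
    have fx: "0 < f x" using f(1)[of x] f(2) by linarith
    have "ln (f x / a) \<le> f x / a - 1" using a fx by (intro ln_le_minus_one) simp
    then show ?thesis using a fx by (simp add: ln_div field_simps)
  qed
  then have "expectation (\<lambda>x. ln (f x)) \<le> expectation (\<lambda>x. ln a + (f x - a) / a)"
    using i by (intro integral_mono) auto
  also have "\<dots> = ln a" using i a prob_space by (simp add: a_def[symmetric])
  finally show ?thesis by (simp add: a_def)
qed

text \<open>
  The law of the Euler scheme driven by the Brownian increments is given by the iterated Markov
  operator, and the scheme converges to the solution along almost every path.
\<close>

lemma euler_expectation_converges:
  fixes X N :: "real \<Rightarrow> 'a \<Rightarrow> real ^ 'n"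
  assumes bm: "brownian_motion M 2 N" and L: "L-lipschitz_on UNIV (gradient U)"
    and sol: "langevin_solution M N U x X" and t: "0 < t"
    and \<phi>: "continuous_on UNIV \<phi>" "\<And>x. \<bar>\<phi> x\<bar> \<le> B"
  shows "(\<lambda>m. let h = t / real (Suc m) in (step_op (euler_map U h) (sqrt (2 * h)) ^^ Suc m) \<phi> x)
    \<longlonglongrightarrow> (\<integral>\<omega>. \<phi> (X t \<omega>) \<partial>M)"
proof -
  interpret prob_space M by (rule brownian_motion_prob_space[OF bm])
  have [measurable]: "\<phi> \<in> borel_measurable borel" using \<phi>(1) by (rule borel_measurable_continuous_onI)
  have gm [measurable]: "gradient U \<in> borel_measurable borel"
    by (rule borel_measurable_continuous_onI[OF lipschitz_on_continuous_on[OF L]])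
  note Nm = brownian_motion_measurable[OF bm]
  have [measurable]: "X t \<in> borel_measurable M" using sol t by (simp add: langevin_solution_def)
  define h where "h m = t / real (Suc m)" for m
  define \<xi> where "\<xi> m j \<omega> = N (real (Suc j) * h m) \<omega> - N (real j * h m) \<omega>" for m j \<omega>
  define Y where "Y m \<omega> = euler_path (euler_map U (h m)) x (\<lambda>j. \<xi> m j \<omega>) (Suc m)" for m \<omega>
  have h: "0 < h m" for m using t by (simp add: h_def)
  have em [measurable]: "euler_map U (h m) \<in> borel_measurable borel" for m
    unfolding euler_map_def[abs_def] by measurable
  have \<xi>m [measurable]: "\<xi> m j \<in> borel_measurable M" for m j
    unfolding \<xi>_def using h[of m] by (intro borel_measurable_diff Nm) (auto simp: less_imp_le)
  have Ym [measurable]: "Y m \<in> borel_measurable M" for m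
  proof -
    have "(\<lambda>\<omega>. euler_path (euler_map U (h m)) x (\<lambda>j. \<xi> m j \<omega>) k) \<in> borel_measurable M" for k
      by (induction k) auto
    then show ?thesis unfolding Y_def .
  qed
  have step: "real (Suc j) * h m = real j * h m + h m" for j m by (simp add: algebra_simps)
  have law: "expectation (\<lambda>\<omega>. \<phi> (Y m \<omega>)) = (step_op (euler_map U (h m)) (sqrt (2 * h m)) ^^ Suc m) \<phi> x" for m
    unfolding Y_def
  proof (rule euler_path_expectation)
    show "indep_vars (\<lambda>_. borel) (\<xi> m) {..<Suc m}"
      unfolding \<xi>_def using h[of m]
      by (intro brownian_motion_indep[OF bm, of "\<lambda>i. real i * h m"]) (auto intro!: mult_right_mono)
    show "distr M borel (\<xi> m j) = gauss (sqrt (2 * h m))" for j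
      unfolding \<xi>_def step using h[of m] by (intro distr_brownian_increment[OF bm]) auto
    show "- B \<le> \<phi> x" "\<phi> x \<le> B" for x using \<phi>(2)[of x] by auto
  qed (use h[of m] in auto)
  have conv: "AE \<omega> in M. (\<lambda>m. Y m \<omega>) \<longlonglongrightarrow> X t \<omega>"
    using sol unfolding langevin_solution_def
  proof (elim conjE, elim eventually_mono)
    fix \<omega>
    assume *: "X 0 \<omega> = x \<and> continuous_on {0..} (\<lambda>t. X t \<omega>)
        \<and> (\<forall>t\<ge>0. X t \<omega> = x - integral {0..t} (\<lambda>s. gradient U (X s \<omega>)) + N t \<omega>)"
    show "(\<lambda>m. Y m \<omega>) \<longlonglongrightarrow> X t \<omega>"
      using euler_path_converges[OF L, of "\<lambda>t. X t \<omega>" x "\<lambda>t. N t \<omega>" t] * t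
      by (simp add: Let_def Y_def \<xi>_def[abs_def] h_def[abs_def] euler_map_def[abs_def] del: of_nat_Suc euler_path.simps)
  qed
  have "(\<lambda>m. expectation (\<lambda>\<omega>. \<phi> (Y m \<omega>))) \<longlonglongrightarrow> expectation (\<lambda>\<omega>. \<phi> (X t \<omega>))"
  proof (rule integral_dominated_convergence[where w = "\<lambda>_. B"])
    show "AE \<omega> in M. (\<lambda>m. \<phi> (Y m \<omega>)) \<longlonglongrightarrow> \<phi> (X t \<omega>)"
      using conv
    proof eventually_elim
      case (elim \<omega>)
      then show ?case using \<phi>(1) by (intro isCont_tendsto_compose[of _ \<phi>]) (auto simp: continuous_on_eq_continuous_at)
    qed
  qed (use \<phi>(2) in auto)
  then show ?thesis unfolding law by (simp only: Let_def h_def)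
qed

text \<open>
  The chain inequality compares the start in \<open>x\<close> with the start in an arbitrary \<open>y\<close>. Averaging it over
  \<open>y\<close> under \<open>\<mu>\<close> and moving the average inside the logarithm produces the mean of the iterated
  operator under \<open>\<mu>\<close>, which almost invariance replaces by the mean of \<open>exp \<phi>\<close>. With
  \<open>k\<close> steps of length \<open>h = t / k\<close> and noise of variance \<open>s\<^sup>2 = 2 h\<close>, the constant \<open>2 k s\<^sup>2\<close> is \<open>4 t\<close>.
\<close>

lemma langevin_entropy_bound_continuous:
  fixes X N :: "real \<Rightarrow> 'a \<Rightarrow> real ^ 'n" and U :: "real ^ 'n \<Rightarrow> real"
  defines "\<mu> \<equiv> gibbs_measure U"
  assumes bm: "brownian_motion M 2 N" and C2: "C2 U" and L: "L-lipschitz_on UNIV (gradient U)"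
    and sol: "langevin_solution M N U x X" and pr: "prob_space \<mu>"
    and mom: "integrable \<mu> (\<lambda>x. (norm x)\<^sup>2)"
    and psd: "\<And>x v. 0 \<le> v \<bullet> (hessian U x *v v)" and t: "0 < t"
    and \<phi>: "continuous_on UNIV \<phi>" "\<And>x. \<bar>\<phi> x\<bar> \<le> B"
  shows "(\<integral>\<omega>. \<phi> (X t \<omega>) \<partial>M) \<le> ln (\<integral>y. exp (\<phi> y) \<partial>\<mu>) + (\<integral>y. (norm (x - y))\<^sup>2 \<partial>\<mu>) / (4 * t)"
proof -
  interpret \<mu>: prob_space \<mu> by (rule pr)
  have U: "\<And>x. U differentiable (at x)" and U2: "\<And>x. gradient U differentiable (at x)"
    using C2 by (auto simp: C2_def)
  have mono: "0 \<le> (x - y) \<bullet> (gradient U x - gradient U y)" for x y by (rule gradient_monotone[OF U2 psd])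
  have \<phi>m [measurable]: "\<phi> \<in> borel_measurable borel" using \<phi>(1) by (rule borel_measurable_continuous_onI)
  have Um [measurable]: "U \<in> borel_measurable borel"
    using U differentiable_imp_continuous_within by (intro borel_measurable_continuous_onI continuous_at_imp_continuous_on) blast
  have gm [measurable]: "gradient U \<in> borel_measurable borel"
    by (rule borel_measurable_continuous_onI[OF lipschitz_on_continuous_on[OF L]])
  define Z where "Z = (\<integral>y. exp (- U y) \<partial>lborel)"
  define \<rho> where "\<rho> x = exp (- U x) / Z" for x
  have Z0: "0 \<le> Z" unfolding Z_def by (rule integral_nonneg_AE) simp
  have \<rho>0: "0 \<le> \<rho> x" for x using Z0 by (simp add: \<rho>_def)
  have \<rho>m [measurable]: "\<rho> \<in> borel_measurable borel" unfolding \<rho>_def[abs_def] by measurable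
  have \<mu>_eq: "\<mu> = density lborel (\<lambda>x. ennreal (\<rho> x))" by (simp add: \<mu>_def gibbs_measure_def \<rho>_def Z_def)
  have s\<mu> [simp, measurable_cong]: "sets \<mu> = sets borel" by (simp add: \<mu>_eq)
  define h where "h m = t / real (Suc m)" for m
  define s where "s m = sqrt (2 * h m)" for m
  define g where "g m = euler_map U (h m)" for m
  define q where "q m = 1 + (h m)\<^sup>2 * L\<^sup>2" for m
  have h: "0 < h m" "h m \<le> t" for m using t by (auto simp: h_def field_simps)
  have h0: "h \<longlonglongrightarrow> 0"
    using tendsto_mult_right_zero[OF LIMSEQ_Suc[OF lim_1_over_n], of t] by (simp add: h_def[abs_def])
  have s: "0 < s m" for m using h(1)[of m] by (simp add: s_def)
  have gm' [measurable]: "g m \<in> borel_measurable borel" for m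
    unfolding g_def euler_map_def[abs_def] by measurable
  have kh: "real (Suc m) * h m = t" for m by (simp add: h_def)
  obtain e where e: "\<And>n. 0 \<le> e n" "e \<longlonglongrightarrow> 0"
    "\<And>n. (\<integral>\<^sup>+x. (\<integral>\<^sup>+z. ennreal \<bar>reversal_exponent U (h n) x (g n x + z)\<bar> \<partial>gauss (s n)) \<partial>\<mu>) \<le> ennreal (h n * e n)"
    using reversal_exponent_mean_little_o[OF U U2 L pr s\<mu> mom h h0] unfolding g_def s_def by blast
  define f where "f y = exp (\<phi> y)" for y
  have fm: "f \<in> borel_measurable borel" unfolding f_def by measurable
  have fb: "exp (- B) \<le> f y" "f y \<le> exp B" for y using \<phi>(2)[of y] by (auto simp: f_def abs_le_iff)
  have f0: "0 \<le> f y" for y by (simp add: f_def)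
  define E where "E m = (step_op (g m) (s m) ^^ Suc m) f" for m
  have Em [measurable]: "E m \<in> borel_measurable borel" and Eb: "\<And>y. exp (- B) \<le> E m y" "\<And>y. E m y \<le> exp B" for m
    unfolding E_def by (rule step_op_iterate_measurable[OF s gm' fm fb] step_op_iterate_lower[OF s gm' fm fb] step_op_iterate_upper[OF s gm' fm fb])+
  have lnE: "- B \<le> ln (E m y)" "ln (E m y) \<le> B" for m y
  proof -
    have "0 < E m y" using Eb(1)[of m y] exp_gt_zero[of "- B"] by linarith
    then have "ln (exp (- B)) \<le> ln (E m y)" "ln (E m y) \<le> ln (exp B)"
      using Eb[of m y] by (auto simp del: ln_exp intro!: ln_mono)
    then show "- B \<le> ln (E m y)" "ln (E m y) \<le> B" by simp_all
  qed
  have iE: "integrable \<mu> (E m)" for m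
    by (rule \<mu>.integrable_const_bound[where B = "exp B"]) (use Eb order_trans[OF exp_ge_zero Eb(1)] in auto)
  have ilnE: "integrable \<mu> (\<lambda>y. ln (E m y))" for m
    by (rule \<mu>.integrable_const_bound[where B = B]) (use lnE in \<open>auto simp: abs_le_iff minus_le_iff\<close>)
  have i1: "integrable \<mu> (\<lambda>y. (norm (x - y))\<^sup>2)"
  proof (rule Bochner_Integration.integrable_bound)
    show "integrable \<mu> (\<lambda>y. 2 * (norm x)\<^sup>2 + 2 * (norm y)\<^sup>2)" using mom by simp
    have "(norm (x - y))\<^sup>2 \<le> 2 * (norm x)\<^sup>2 + 2 * (norm y)\<^sup>2" for y
    proof -
      have "(norm (x - y))\<^sup>2 \<le> (norm x + norm y)\<^sup>2" by (intro power_mono norm_triangle_ineq4) simp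
      then show ?thesis using zero_le_power2[of "norm x - norm y"] by (simp add: power2_sum power2_diff)
    qed
    then show "AE y in \<mu>. norm ((norm (x - y))\<^sup>2) \<le> norm (2 * (norm x)\<^sup>2 + 2 * (norm y)\<^sup>2)" by simp
  qed simp
  define C where "C = (\<integral>y. (norm (x - y))\<^sup>2 \<partial>\<mu>)"
  have C0: "0 \<le> C" unfolding C_def by (rule integral_nonneg_AE) simp
  have qk: "q m ^ Suc m \<le> exp (t * L\<^sup>2 * h m)" for m
  proof -
    have "q m ^ Suc m \<le> exp ((h m)\<^sup>2 * L\<^sup>2) ^ Suc m"
      unfolding q_def by (intro power_mono exp_ge_add_one_self) simp
    also have "\<dots> = exp (real (Suc m) * ((h m)\<^sup>2 * L\<^sup>2))" by (rule exp_of_nat_mult[symmetric])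
    also have "real (Suc m) * ((h m)\<^sup>2 * L\<^sup>2) = (real (Suc m) * h m) * L\<^sup>2 * h m"
      by (simp only: power2_eq_square mult_ac)
    finally show ?thesis unfolding kh .
  qed
  have bound: "(step_op (g m) (s m) ^^ Suc m) \<phi> x
      \<le> ln ((\<integral>y. f y \<partial>\<mu>) + exp B * t * e m) + exp (t * L\<^sup>2 * h m) * C / (4 * t)" for m
  proof -
    have "(step_op (g m) (s m) ^^ Suc m) \<phi> x \<le> ln (E m y) + exp (t * L\<^sup>2 * h m) / (4 * t) * (norm (x - y))\<^sup>2" for y
    proof -
      have "(step_op (g m) (s m) ^^ Suc m) \<phi> x \<le> ln (E m y) + q m ^ Suc m * (norm (x - y))\<^sup>2 / (2 * real (Suc m) * (s m)\<^sup>2)"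
        unfolding E_def f_def
      proof (rule chain_log_harnack[OF s gm' _ _ \<phi>m \<phi>(2)])
        show "(norm (g m u - g m v))\<^sup>2 \<le> q m * (norm (u - v))\<^sup>2" for u v
          unfolding g_def q_def by (rule euler_map_lipschitz[OF mono L]) (use h(1)[of m] in simp)
      qed (simp add: q_def)
      also have "2 * real (Suc m) * (s m)\<^sup>2 = 4 * (real (Suc m) * h m)"
        using h(1)[of m] by (simp add: s_def)
      also have "q m ^ Suc m * (norm (x - y))\<^sup>2 / (4 * (real (Suc m) * h m)) \<le> exp (t * L\<^sup>2 * h m) * (norm (x - y))\<^sup>2 / (4 * t)"
        unfolding kh using t by (intro divide_right_mono mult_right_mono qk) auto
      finally show ?thesis by simp
    qed
    then have "(\<integral>y. (step_op (g m) (s m) ^^ Suc m) \<phi> x \<partial>\<mu>) \<le> (\<integral>y. ln (E m y) + exp (t * L\<^sup>2 * h m) / (4 * t) * (norm (x - y))\<^sup>2 \<partial>\<mu>)"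
      using ilnE i1 by (intro integral_mono) auto
    then have 1: "(step_op (g m) (s m) ^^ Suc m) \<phi> x \<le> (\<integral>y. ln (E m y) \<partial>\<mu>) + exp (t * L\<^sup>2 * h m) * C / (4 * t)"
      using ilnE i1 \<mu>.prob_space by (simp add: C_def del: funpow.simps)
    have 2: "(\<integral>y. ln (E m y) \<partial>\<mu>) \<le> ln (\<integral>y. E m y \<partial>\<mu>)"
      by (rule \<mu>.expectation_ln_le[OF iE ilnE Eb(1)]) simp
    have "(\<integral>y. E m y \<partial>\<mu>) \<le> (\<integral>y. f y \<partial>\<mu>) + real (Suc m) * (exp B * (h m * e m))"
      unfolding E_def \<mu>_eq
    proof (rule chain_almost_invariant[OF s gm' \<rho>m _ \<rho>0 _ _ _ _ fm f0 fb(2)])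
      show "(\<lambda>(x, y). reversal_exponent U (h m) x y) \<in> borel_measurable (borel \<Otimes>\<^sub>M borel)"
        unfolding reversal_exponent_def by measurable
      show "\<rho> y * gauss_density (s m) (x - g m y) = \<rho> x * gauss_density (s m) (y - g m x) * exp (reversal_exponent U (h m) x y)" for x y
        using euler_almost_reversible[OF h(1)[of m], of U y x] by (simp add: \<rho>_def s_def g_def)
    qed (use pr e h(1)[of m] in \<open>simp_all add: \<mu>_eq\<close>)
    also have "real (Suc m) * (exp B * (h m * e m)) = exp B * (real (Suc m) * h m) * e m" by (simp only: mult_ac)
    finally have "(\<integral>y. E m y \<partial>\<mu>) \<le> (\<integral>y. f y \<partial>\<mu>) + exp B * t * e m" unfolding kh .
    moreover have "0 < (\<integral>y. E m y \<partial>\<mu>)"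
      using \<mu>.integral_ge_const[OF iE, of "exp (- B)" m] Eb exp_gt_zero[of "- B"] by (smt (verit) always_eventually)
    ultimately have "ln (\<integral>y. E m y \<partial>\<mu>) \<le> ln ((\<integral>y. f y \<partial>\<mu>) + exp B * t * e m)" by simp
    with 1 2 show ?thesis by linarith
  qed
  have fpos: "0 < (\<integral>y. f y \<partial>\<mu>)"
  proof -
    have "integrable \<mu> f"
      by (rule \<mu>.integrable_const_bound[where B = "exp B"]) (use fb f0 fm in auto)
    then have "exp (- B) \<le> (\<integral>y. f y \<partial>\<mu>)" by (rule \<mu>.integral_ge_const) (simp add: fb)
    then show ?thesis using exp_gt_zero[of "- B"] by linarith
  qed
  have "(\<integral>\<omega>. \<phi> (X t \<omega>) \<partial>M) \<le> ln ((\<integral>y. f y \<partial>\<mu>) + exp B * t * 0) + exp (t * L\<^sup>2 * 0) * C / (4 * t)"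
  proof (rule LIMSEQ_le)
    show "(\<lambda>m. (step_op (g m) (s m) ^^ Suc m) \<phi> x) \<longlonglongrightarrow> (\<integral>\<omega>. \<phi> (X t \<omega>) \<partial>M)"
      using euler_expectation_converges[OF bm L sol t \<phi>] by (simp only: Let_def g_def s_def h_def)
    show "(\<lambda>m. ln ((\<integral>y. f y \<partial>\<mu>) + exp B * t * e m) + exp (t * L\<^sup>2 * h m) * C / (4 * t))
        \<longlonglongrightarrow> ln ((\<integral>y. f y \<partial>\<mu>) + exp B * t * 0) + exp (t * L\<^sup>2 * 0) * C / (4 * t)"
      using fpos t by (intro tendsto_intros e(2) h0) auto
  qed (use bound in blast)
  then show ?thesis by (simp add: f_def C_def)
qed

theorem theorem4p10:
  fixes M :: "'a measure"
    and N :: "real \<Rightarrow> 'a \<Rightarrow> real ^ 'n"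
    and U :: "real ^ 'n \<Rightarrow> real"
    and X :: "real ^ 'n \<Rightarrow> real \<Rightarrow> 'a \<Rightarrow> real ^ 'n"
  assumes "brownian_motion M 2 N"
    and "C2 U"
    and "\<exists>L. L-lipschitz_on UNIV (gradient U)"
    and "\<And>x. langevin_solution M N U x (X x)"
    and "prob_space (gibbs_measure U)"
    and "integrable (gibbs_measure U) (\<lambda>x. (norm x)\<^sup>2)"
    and "\<And>x v. 0 \<le> v \<bullet> (hessian U x *v v)"
  shows "(\<forall>x. \<forall>t>0. hellinger2_sq (dirac_semigroup M X x t) (gibbs_measure U)
            \<le> ennreal (1 / (4 * t)) * wasserstein2_sq (return borel x) (gibbs_measure U))
       \<and> (\<forall>x. ((\<lambda>t. total_variation (dirac_semigroup M X x t) (gibbs_measure U)) \<longlongrightarrow> 0) at_top)"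
proof -
  define \<mu> where "\<mu> = gibbs_measure U"
  obtain L where L: "L-lipschitz_on UNIV (gradient U)" using assms(3) by blast
  interpret prob_space M by (rule brownian_motion_prob_space[OF assms(1)])
  interpret \<mu>: prob_space \<mu> using assms(5) by (simp add: \<mu>_def)
  have s\<mu>: "sets \<mu> = sets borel" by (simp add: \<mu>_def gibbs_measure_def)
  define C where "C x = (\<integral>y. (norm (x - y))\<^sup>2 \<partial>\<mu>)" for x
  have C0: "0 \<le> C x" for x unfolding C_def by (rule integral_nonneg_AE) simp
  have Xm: "X x t \<in> borel_measurable M" if "0 < t" for x t
    using assms(4)[of x] that by (simp add: langevin_solution_def)
  have s\<nu>: "sets (dirac_semigroup M X x t) = sets borel" for x t by (simp add: dirac_semigroup_def)
  have pr: "prob_space (dirac_semigroup M X x t)" if "0 < t" for x t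
    unfolding dirac_semigroup_def by (rule prob_space_distr[OF Xm[OF that]])
  have H: "hellinger2_sq (dirac_semigroup M X x t) \<mu> \<le> ennreal (C x / (4 * t))" if t: "0 < t" for x t
  proof (rule hellinger_le_entropy_bound)
    show "prob_space (dirac_semigroup M X x t)" by (rule pr[OF t])
    show "prob_space \<mu>" by (rule \<mu>.prob_space_axioms)
    show "sets (dirac_semigroup M X x t) = sets \<mu>" by (simp add: s\<nu> s\<mu>)
    fix \<phi> :: "real ^ 'n \<Rightarrow> real" and B
    assume "\<phi> \<in> borel_measurable \<mu>" and B: "\<And>x. \<bar>\<phi> x\<bar> \<le> B"
    then have \<phi>: "\<phi> \<in> borel_measurable borel" using measurable_cong_sets[OF s\<mu> refl] by blast
    show "(\<integral>y. \<phi> y \<partial>dirac_semigroup M X x t) \<le> ln (\<integral>y. exp (\<phi> y) \<partial>\<mu>) + C x / (4 * t)"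
    proof (rule entropy_bound_extend[OF pr[OF t] \<mu>.prob_space_axioms s\<nu> s\<mu> _ \<phi> B])
      fix \<psi> :: "real ^ 'n \<Rightarrow> real" and B'
      assume \<psi>: "continuous_on UNIV \<psi>" "\<And>x. \<bar>\<psi> x\<bar> \<le> B'"
      have "(\<integral>y. \<psi> y \<partial>dirac_semigroup M X x t) = (\<integral>\<omega>. \<psi> (X x t \<omega>) \<partial>M)"
        unfolding dirac_semigroup_def
        by (rule integral_distr[OF Xm[OF t] borel_measurable_continuous_onI[OF \<psi>(1)]])
      with langevin_entropy_bound_continuous[OF assms(1,2) L assms(4-7) t \<psi>, of x]
      show "(\<integral>y. \<psi> y \<partial>dirac_semigroup M X x t) \<le> ln (\<integral>y. exp (\<psi> y) \<partial>\<mu>) + C x / (4 * t)"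
        by (simp add: C_def \<mu>_def)
    qed
  qed
  have "hellinger2_sq (dirac_semigroup M X x t) \<mu> \<le> ennreal (1 / (4 * t)) * wasserstein2_sq (return borel x) \<mu>"
    if t: "0 < t" for x t
  proof -
    have "ennreal (C x) \<le> (\<integral>\<^sup>+y. ennreal ((norm (x - y))\<^sup>2) \<partial>\<mu>)"
    proof (cases "integrable \<mu> (\<lambda>y. (norm (x - y))\<^sup>2)")
      case True
      then show ?thesis unfolding C_def by (subst nn_integral_eq_integral) auto
    qed (simp add: C_def not_integrable_integral_eq)
    also have "\<dots> \<le> wasserstein2_sq (return borel x) \<mu>" by (rule second_moment_le_wasserstein)
    finally have W: "ennreal (C x) \<le> wasserstein2_sq (return borel x) \<mu>" .
    have "ennreal (C x / (4 * t)) = ennreal (1 / (4 * t)) * ennreal (C x)"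
      using t C0[of x] by (simp add: ennreal_mult[symmetric])
    also have "\<dots> \<le> ennreal (1 / (4 * t)) * wasserstein2_sq (return borel x) \<mu>"
      by (rule mult_left_mono[OF W]) simp
    finally show ?thesis using H[OF t, of x] by (rule order_trans[rotated])
  qed
  moreover have "((\<lambda>t. total_variation (dirac_semigroup M X x t) \<mu>) \<longlongrightarrow> 0) at_top" for x
  proof (rule tendsto_sandwich[OF _ _ tendsto_const])
    \<comment> \<open>The parameter \<open>a = sqrt t\<close> balances the two terms, as the Hellinger bound decays like \<open>1 / t\<close>.\<close>
    have TV: "total_variation (dirac_semigroup M X x t) \<mu> \<le> (sqrt t * (C x / (4 * t)) + 4 / sqrt t) / 2"
      "0 \<le> total_variation (dirac_semigroup M X x t) \<mu>" if t: "0 < t" for t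
      by (rule total_variation_le_hellinger[OF pr[OF t] \<mu>.prob_space_axioms _ H[OF t]]; use t C0[of x] in \<open>simp add: s\<nu> s\<mu>\<close>)+
    show "\<forall>\<^sub>F t in at_top. 0 \<le> total_variation (dirac_semigroup M X x t) \<mu>"
      using eventually_gt_at_top[of 0] by eventually_elim (rule TV(2))
    show "\<forall>\<^sub>F t in at_top. total_variation (dirac_semigroup M X x t) \<mu> \<le> (C x / 8 + 2) * inverse (sqrt t)"
      using eventually_gt_at_top[of 0]
    proof eventually_elim
      case (elim t)
      have "sqrt t * (C x / (4 * t)) = C x / 4 * inverse (sqrt t)"
        using elim by (simp add: field_simps)
      then have "(sqrt t * (C x / (4 * t)) + 4 / sqrt t) / 2 = (C x / 8 + 2) * inverse (sqrt t)"
        unfolding divide_inverse[of 4 "sqrt t"] by (simp add: algebra_simps)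
      with TV(1)[OF elim] show ?case by simp
    qed
    show "((\<lambda>t. (C x / 8 + 2) * inverse (sqrt t)) \<longlongrightarrow> 0) at_top"
      by (intro tendsto_mult_right_zero tendsto_inverse_0_at_top sqrt_at_top)
  qed
  ultimately show ?thesis by (simp add: \<mu>_def)
qed

end
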